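(* There exists a subset $\Gamma\subset E^1(\mathbb S^1)$ which contains exactly one element from each equivalence class $E^1_\omega(\mathbb S^1)$, $\omega\in K$, such that $C^{1+mod}$-generic maps $f\in\Gamma$ have unbounded distortion; that is, the set of $f\in\Gamma$ with unbounded distortion is residual in $\Gamma$ with respect to the topology induced on $\Gamma$ by the metric $d_{1+mod}$.
   Context: $\mathbb R^+=[0,\infty)$; $\mathbb S^1=\mathbb R/\mathbb Z$ with the arc-length metric $d$. $E^1(\mathbb S^1)$ is the set of $C^1$ uniformly expanding maps $f:\mathbb S^1\to\mathbb S^1$ (i.e. $\min|f'|>1$). For a continuous real function $\rho$ on a compact metric space $X$, the canonical modulus of continuity is $\omega_\rho(t)=\sup\{|\rho(x)-\rho(y)|: d(x,y)<t\}$ for $t>0$, with $\omega_\rho(0)=0$. $K$ is the set of continuous, non-decreasing, concave functions $\omega:\mathbb R^+\to\mathbb R^+$ with $\omega(0)=0$ and $\omega\not\equiv0$. For moduli of continuity, $\omega\simeq\tilde\omega$ means that the ratio $\omega/\tilde\omega$ is bounded above and bounded below by positive constants on some interval $(0,t_0]$, $t_0>0$. $E^1_\omega(\mathbb S^1)=\{f\in E^1(\mathbb S^1):\omega_{f'}\simeq\omega\}$; one has $E^1_\omega=E^1_{\tilde\omega}$ if $\omega\simeq\tilde\omega$ and $E^1_\omega\cap E^1_{\tilde\omega}=\emptyset$ otherwise. The metric $d_{1+mod}$ on $E^1(\mathbb S^1)$ is $d_{1+mod}(f,g)=d_1(f,g)+d_0(\omega_{f'},\omega_{g'})$, where $d_1$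 is the $C^1$ distance and $d_0$ is the $C^0$ (sup) distance. The topology it induces is called the $C^{1+mod}$-topology. A subset is residual if it contains a countable intersection of open dense sets. For $f\in E^1(\mathbb S^1)$ and $n\ge1$, let $\{\omega^{(n)}_i\}$ be the injectivity domains of $f^n$: fixing a fixed point $p$ of $f$, these are the arcs between consecutive points of $f^{-n}(p)$. $f$ has bounded distortion if $$\sup_{n\ge1}\ \sup_{\omega^{(n)}_i}\ \sup_{x,y\in\omega^{(n)}_i}\log\frac{(f^n)'(x)}{(f^n)'(y)}<\infty ,$$ and unbounded distortion otherwise. *)

theory Defs
  imports "HOL-Analysis.Analysis"
begin

quotient_type circle = real / "\<lambda>x y. x - y \<in> \<int>"
  morphisms circle_rep to_circle
proof (rule equivpI)
  show "reflp (\<lambda>x y::real. x - y \<in> \<int>)"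
    by (simp add: reflp_def)
  show "symp (\<lambda>x y::real. x - y \<in> \<int>)"
    by (metis (no_types, lifting) Ints_minus minus_diff_eq sympI)
  show "transp (\<lambda>x y::real. x - y \<in> \<int>)"
    by (rule transpI) (metis Ints_add diff_add_cancel add_diff_eq)
qed

lemma to_circle_eq_iff: "to_circle x = to_circle y \<longleftrightarrow> x - y \<in> \<int>"
  by (rule circle.abs_eq_iff)

lemma to_circle_cases: obtains x where "\<theta> = to_circle x"
  by (induct \<theta>) blast

lemma INF_int_translates:
  "(INF k::int. \<bar>z + of_int k\<bar> :: real) = \<bar>z - of_int (round z)\<bar>"
proof (rule cInf_eq_minimum)
  show "\<bar>z - of_int (round z)\<bar> \<in> range (\<lambda>k::int. \<bar>z + of_int k\<bar>)"
    by (rule image_eqI[where x = "- round z"]) auto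
next
  fix a assume "a \<in> range (\<lambda>k::int. \<bar>z + of_int k\<bar>)"
  then obtain k :: int where "a = \<bar>z + of_int k\<bar>" by auto
  then show "\<bar>z - of_int (round z)\<bar> \<le> a"
    using round_diff_minimal[of z "- k"] by simp
qed

instantiation circle :: metric_space
begin

lift_definition dist_circle :: "circle \<Rightarrow> circle \<Rightarrow> real"
  is "\<lambda>x y. INF k::int. \<bar>x - y + of_int k\<bar>"
proof -
  fix x x' y y' :: real
  assume "x - x' \<in> \<int>" "y - y' \<in> \<int>"
  then have "(x - x') - (y - y') \<in> \<int>" by (rule Ints_diff)
  then obtain m :: int where m: "(x - x') - (y - y') = of_int m" by (auto elim: Ints_cases)
  have "(\<lambda>k::int. \<bar>x - y + of_int k\<bar>) = (\<lambda>k. \<bar>x' - y' + of_int k\<bar>) \<circ> (\<lambda>k. k + m)"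
    using m by (auto simp: fun_eq_iff algebra_simps)
  then have "range (\<lambda>k::int. \<bar>x - y + of_int k\<bar>) = (\<lambda>k. \<bar>x' - y' + of_int k\<bar>) ` range (\<lambda>k. k + m)"
    by (metis image_comp)
  also have "range (\<lambda>k. k + m) = UNIV" by (metis surj_def diff_add_cancel)
  finally show "(INF k::int. \<bar>x - y + of_int k\<bar>) = (INF k::int. \<bar>x' - y' + of_int k\<bar>)"
    by simp
qed

definition uniformity_circle :: "(circle \<times> circle) filter"
  where "uniformity_circle = (INF e\<in>{0 <..}. principal {(x, y). dist x y < e})"

definition open_circle :: "circle set \<Rightarrow> bool"
  where "open_circle U \<longleftrightarrow>
    (\<forall>x\<in>U. eventually (\<lambda>(x', y). x' = x \<longrightarrow> y \<in> U) uniformity)"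

lemma dist_to_circle_round:
  "dist (to_circle x) (to_circle y) = \<bar>x - y - of_int (round (x - y))\<bar>"
  unfolding dist_circle.abs_eq by (rule INF_int_translates)

lemma dist_to_circle_le: "dist (to_circle x) (to_circle y) \<le> \<bar>x - y + of_int k\<bar>"
  unfolding dist_to_circle_round using round_diff_minimal[of "x - y" "- k"] by simp

instance
proof
  fix a b c :: circle
  obtain x y z where abc: "a = to_circle x" "b = to_circle y" "c = to_circle z"
    by (meson to_circle_cases)
  show "dist a b = 0 \<longleftrightarrow> a = b"
  proof
    assume "dist a b = 0"
    then have "x - y = of_int (round (x - y))" by (simp add: abc dist_to_circle_round)
    then show "a = b" unfolding abc to_circle_eq_iff by (metis Ints_of_int)
  next
    assume "a = b"
    then have "x - y \<in> \<int>" by (simp add: abc to_circle_eq_iff)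
    then show "dist a b = 0" unfolding abc dist_to_circle_round by (auto elim: Ints_cases)
  qed
  have "dist a b \<le> \<bar>x - y + of_int (- round (x - z) + round (y - z))\<bar>"
    unfolding abc by (rule dist_to_circle_le)
  also have "\<dots> \<le> dist a c + dist b c"
    unfolding abc dist_to_circle_round by simp
  finally show "dist a b \<le> dist a c + dist b c" .
qed (simp_all add: uniformity_circle_def open_circle_def)

end

text \<open>Every continuous circle map has a continuous lift to the real line; it is of class $C^1$
  iff its lifts are, and its derivative is the derivative of any lift.\<close>

definition C1_lift :: "(circle \<Rightarrow> circle) \<Rightarrow> (real \<Rightarrow> real) \<Rightarrow> bool" where
  "C1_lift f F \<longleftrightarrow> F C1_differentiable_on UNIV \<and> (\<forall>x. to_circle (F x) = f (to_circle x))"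

definition C1_map :: "(circle \<Rightarrow> circle) \<Rightarrow> bool" where
  "C1_map f \<longleftrightarrow> (\<exists>F. C1_lift f F)"

text \<open>The value 0 for maps that are not of class $C^1$ is a dummy.\<close>

definition circle_deriv :: "(circle \<Rightarrow> circle) \<Rightarrow> circle \<Rightarrow> real" where
  "circle_deriv f \<theta> =
    (if C1_map f
     then THE D. \<exists>F x. C1_lift f F \<and> to_circle x = \<theta> \<and> (F has_real_derivative D) (at x)
     else 0)"

text \<open>By compactness the infimum is a minimum.\<close>

definition E1 :: "(circle \<Rightarrow> circle) set" where
  "E1 = {f. C1_map f \<and> 1 < (INF \<theta>. \<bar>circle_deriv f \<theta>\<bar>)}"

definition modulus :: "('a::metric_space \<Rightarrow> real) \<Rightarrow> real \<Rightarrow> real" where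
  "modulus \<rho> t = (if t \<le> 0 then 0 else Sup {\<bar>\<rho> x - \<rho> y\<bar> | x y. dist x y < t})"

text \<open>Only the restriction of a member of \<open>concave_moduli\<close> to \<open>{0..}\<close> is meaningful.\<close>

definition concave_moduli :: "(real \<Rightarrow> real) set" where
  "concave_moduli = {\<omega>. continuous_on {0..} \<omega> \<and> mono_on {0..} \<omega> \<and> concave_on {0..} \<omega> \<and>
     (\<forall>t\<ge>0. 0 \<le> \<omega> t) \<and> \<omega> 0 = 0 \<and> (\<exists>t\<ge>0. \<omega> t \<noteq> 0)}"

text \<open>If \<open>\<omega>' t = 0\<close> the quotient is 0, so the positive lower bound fails: a modulus vanishing
  near 0 is equivalent to none.\<close>

definition equiv_moduli :: "(real \<Rightarrow> real) \<Rightarrow> (real \<Rightarrow> real) \<Rightarrow> bool" where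
  "equiv_moduli \<omega> \<omega>' \<longleftrightarrow>
    (\<exists>t0>0. \<exists>a>0. \<exists>b>0. \<forall>t\<in>{0<..t0}. a \<le> \<omega> t / \<omega>' t \<and> \<omega> t / \<omega>' t \<le> b)"

definition E1_class :: "(real \<Rightarrow> real) \<Rightarrow> (circle \<Rightarrow> circle) set" where
  "E1_class \<omega> = {f \<in> E1. equiv_moduli (modulus (circle_deriv f)) \<omega>}"

definition sup_dist :: "'a set \<Rightarrow> ('a \<Rightarrow> 'b::metric_space) \<Rightarrow> ('a \<Rightarrow> 'b) \<Rightarrow> real" where
  "sup_dist A u v = (SUP x\<in>A. dist (u x) (v x))"

definition dist_C1 :: "(circle \<Rightarrow> circle) \<Rightarrow> (circle \<Rightarrow> circle) \<Rightarrow> real" where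
  "dist_C1 f g = sup_dist UNIV f g + sup_dist UNIV (circle_deriv f) (circle_deriv g)"

definition dist_C1mod :: "(circle \<Rightarrow> circle) \<Rightarrow> (circle \<Rightarrow> circle) \<Rightarrow> real" where
  "dist_C1mod f g =
    dist_C1 f g + sup_dist {0..} (modulus (circle_deriv f)) (modulus (circle_deriv g))"

lemma circle_dist_le_1: "dist (\<theta> :: circle) \<phi> \<le> 1"
proof -
  obtain x y where "\<theta> = to_circle x" "\<phi> = to_circle y" by (meson to_circle_cases)
  then show ?thesis
    using of_int_round_abs_le[of "x - y"] by (simp add: dist_to_circle_round abs_minus_commute)
qed

lemma C1_lift_unique:
  assumes "C1_lift f F" "C1_lift f G"
  obtains k :: int where "\<And>x. F x = G x + of_int k"
proof -
  have cont: "continuous_on UNIV (\<lambda>x. F x - G x)"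
    using assms unfolding C1_lift_def
    by (intro continuous_on_diff) (auto intro: C1_differentiable_imp_continuous_on)
  have int: "F x - G x \<in> \<int>" for x
    using assms unfolding C1_lift_def by (metis to_circle_eq_iff)
  have "(\<lambda>x. F x - G x) constant_on UNIV"
  proof (rule continuous_discrete_range_constant[OF connected_UNIV cont])
    fix x :: real
    show "\<exists>e>0. \<forall>y. y \<in> UNIV \<and> F y - G y \<noteq> F x - G x \<longrightarrow> e \<le> norm ((F y - G y) - (F x - G x))"
      by (intro exI[of _ 1] conjI allI impI) (auto intro!: Ints_nonzero_abs_ge1 int Ints_diff[OF int int])
  qed
  then obtain c where c: "\<And>x. F x - G x = c" unfolding constant_on_def by auto
  with int[of 0] obtain k :: int where "c = of_int k" by (metis Ints_cases)
  with c have "F x = G x + of_int k" for x by (metis add.commute diff_add_cancel)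
  then show ?thesis by (rule that)
qed

lemma C1_lift_has_derivative:
  assumes "C1_lift f F" shows "(F has_real_derivative deriv F x) (at x)"
  using assms unfolding C1_lift_def C1_differentiable_on_eq
  by (metis UNIV_I real_differentiable_def DERIV_imp_deriv
      has_real_derivative_iff_has_vector_derivative vector_derivative_works)

lemma C1_lift_continuous_deriv:
  assumes "C1_lift f F" shows "continuous_on UNIV (deriv F)"
proof -
  obtain E where E: "\<And>t. (F has_vector_derivative E t) (at t)" "continuous_on UNIV E"
    using assms unfolding C1_lift_def C1_differentiable_on_def by auto
  have "deriv F = E"
    using E(1) by (auto simp: fun_eq_iff intro!: DERIV_imp_deriv
        simp flip: has_real_derivative_iff_has_vector_derivative)
  with E(2) show ?thesis by simp
qed

lemma circle_deriv_eq:
  assumes F: "C1_lift f F" shows "circle_deriv f (to_circle x) = deriv F x"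
proof -
  have "(THE D. \<exists>G y. C1_lift f G \<and> to_circle y = to_circle x \<and> (G has_real_derivative D) (at y))
      = deriv F x"
  proof (rule the_equality)
    show "\<exists>G y. C1_lift f G \<and> to_circle y = to_circle x \<and> (G has_real_derivative deriv F x) (at y)"
      using F C1_lift_has_derivative by blast
  next
    fix D assume "\<exists>G y. C1_lift f G \<and> to_circle y = to_circle x \<and> (G has_real_derivative D) (at y)"
    then obtain G y where G: "C1_lift f G" "to_circle y = to_circle x"
      and D: "(G has_real_derivative D) (at y)" by blast
    from G(2) obtain m :: int where m: "y = x + of_int m"
      unfolding to_circle_eq_iff by (metis Ints_cases add.commute diff_add_cancel)
    define H where "H = (\<lambda>t. G (t + of_int m))"
    have "((\<lambda>t. G (t + of_int m)) has_vector_derivative deriv G (t + of_int m)) (at t)" for t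
      using C1_lift_has_derivative[OF G(1), of "t + of_int m"]
      by (simp add: DERIV_shift flip: has_real_derivative_iff_has_vector_derivative)
    moreover have "continuous_on UNIV (\<lambda>t. deriv G (t + of_int m))"
      using C1_lift_continuous_deriv[OF G(1)]
      by (rule continuous_on_compose2) (auto intro!: continuous_intros)
    ultimately have "H C1_differentiable_on UNIV"
      unfolding C1_differentiable_on_def H_def
      by (intro exI[of _ "\<lambda>t. deriv G (t + of_int m)"]) blast
    moreover have "to_circle (H t) = f (to_circle t)" for t
    proof -
      have "to_circle (t + of_int m) = to_circle t" by (simp add: to_circle_eq_iff)
      then show ?thesis using G(1) by (simp add: H_def C1_lift_def)
    qed
    ultimately have "C1_lift f H" by (simp add: C1_lift_def)
    then obtain k :: int where k: "\<And>t. H t = F t + of_int k" using C1_lift_unique F by blast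
    have "(H has_real_derivative D) (at x)" using D by (simp add: H_def m DERIV_shift)
    moreover have "(H has_real_derivative deriv F x) (at x)"
    proof -
      have "H = (\<lambda>t. F t + of_int k)" using k by auto
      then show ?thesis
        using DERIV_add[OF C1_lift_has_derivative[OF F, of x] DERIV_const[of "of_int k"]] by simp
    qed
    ultimately show "D = deriv F x" by (rule DERIV_unique)
  qed
  then show ?thesis using F by (auto simp: circle_deriv_def C1_map_def)
qed

lemma circle_deriv_bounded: obtains B where "\<And>\<theta>. \<bar>circle_deriv f \<theta>\<bar> \<le> B"
proof (cases "C1_map f")
  case False
  then show ?thesis by (intro that[of 0]) (simp add: circle_deriv_def)
next
  case True
  then obtain F where F: "C1_lift f F" by (auto simp: C1_map_def)
  have "compact (deriv F ` {0..1})"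
    using C1_lift_continuous_deriv[OF F]
    by (metis compact_Icc compact_continuous_image continuous_on_subset subset_UNIV)
  then have "bounded (deriv F ` {0..1})" by (rule compact_imp_bounded)
  then obtain B where B: "\<And>x. x \<in> {0..1} \<Longrightarrow> \<bar>deriv F x\<bar> \<le> B"
    unfolding bounded_iff by (metis imageI real_norm_def)
  show ?thesis
  proof (rule that[of B])
    fix \<theta> :: circle
    obtain x where x: "\<theta> = to_circle x" by (rule to_circle_cases)
    then have "\<theta> = to_circle (frac x)" by (simp add: to_circle_eq_iff frac_def)
    moreover have "frac x \<in> {0..1}" using frac_ge_0[of x] frac_lt_1[of x] by auto
    ultimately show "\<bar>circle_deriv f \<theta>\<bar> \<le> B" using B circle_deriv_eq[OF F] by simp
  qed
qed

lemma modulus_bounded: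
  fixes \<rho> :: "'a::metric_space \<Rightarrow> real"
  assumes "\<And>x. \<bar>\<rho> x\<bar> \<le> B" shows "0 \<le> modulus \<rho> t" "modulus \<rho> t \<le> 2 * B"
proof -
  let ?S = "{\<bar>\<rho> x - \<rho> y\<bar> | x y. dist x y < t}"
  have B: "s \<le> 2 * B" if "s \<in> ?S" for s
  proof -
    from that obtain x y where "s = \<bar>\<rho> x - \<rho> y\<bar>" by blast
    then show ?thesis using assms[of x] assms[of y] by linarith
  qed
  have ne: "0 \<in> ?S" if "t > 0" using that by (force intro: exI[of _ undefined])
  have "0 \<le> B" using assms[of undefined] by linarith
  show "0 \<le> modulus \<rho> t"
  proof (cases "t \<le> 0")
    case False
    then have "0 \<le> Sup ?S" using ne B by (intro cSup_upper bdd_aboveI[of _ "2 * B"]) auto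
    then show ?thesis using False by (simp add: modulus_def)
  qed (simp add: modulus_def)
  show "modulus \<rho> t \<le> 2 * B"
  proof (cases "t \<le> 0")
    case False
    then have "Sup ?S \<le> 2 * B" using ne B by (intro cSup_least) auto
    then show ?thesis using False by (simp add: modulus_def)
  qed (use \<open>0 \<le> B\<close> in \<open>simp add: modulus_def\<close>)
qed

lemma sup_dist_commute: "sup_dist A u v = sup_dist A v u"
  by (simp add: sup_dist_def dist_commute)

lemma sup_dist_upper:
  assumes "\<And>x. x \<in> A \<Longrightarrow> dist (u x) (v x) \<le> B" "x \<in> A"
  shows "dist (u x) (v x) \<le> sup_dist A u v"
  unfolding sup_dist_def using assms by (intro cSUP_upper) (auto intro: bdd_aboveI2[of _ _ B])

lemma sup_dist_triangle:
  assumes "\<And>x. x \<in> A \<Longrightarrow> dist (u x) (v x) \<le> B" "\<And>x. x \<in> A \<Longrightarrow> dist (v x) (w x) \<le> C" "A \<noteq> {}"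
  shows "sup_dist A u w \<le> sup_dist A u v + sup_dist A v w"
  unfolding sup_dist_def[of A u w]
proof (rule cSUP_least)
  fix x assume "x \<in> A"
  then show "dist (u x) (w x) \<le> sup_dist A u v + sup_dist A v w"
    using sup_dist_upper[of A u v B x] sup_dist_upper[of A v w C x] assms(1,2)
      dist_triangle[of "u x" "w x" "v x"] by force
qed (rule assms)

lemma sup_dist_nonneg:
  assumes "\<And>x. x \<in> A \<Longrightarrow> dist (u x) (v x) \<le> B" "A \<noteq> {}"
  shows "0 \<le> sup_dist A u v"
  using assms sup_dist_upper[of A u v B] by (meson all_not_in_conv order_trans zero_le_dist)

lemma Metric_space_E1: "Metric_space E1 dist_C1mod"
proof
  have deriv: "\<exists>B. \<forall>\<theta>. dist (circle_deriv f \<theta>) (circle_deriv g \<theta>) \<le> B" for f g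
  proof -
    obtain B C where "\<And>\<theta>. \<bar>circle_deriv f \<theta>\<bar> \<le> B" "\<And>\<theta>. \<bar>circle_deriv g \<theta>\<bar> \<le> C"
      by (meson circle_deriv_bounded)
    then show ?thesis
      by (intro exI[of _ "B + C"]) (metis (no_types, lifting) abs_triangle_ineq4 add_mono dist_real_def order_trans)
  qed
  have modu: "\<exists>B. \<forall>t. dist (modulus (circle_deriv f) t) (modulus (circle_deriv g) t) \<le> B" for f g
  proof -
    obtain B C where BC: "\<And>\<theta>. \<bar>circle_deriv f \<theta>\<bar> \<le> B" "\<And>\<theta>. \<bar>circle_deriv g \<theta>\<bar> \<le> C"
      by (meson circle_deriv_bounded)
    show ?thesis
    proof (intro exI[of _ "2 * B + 2 * C"] allI)
      fix t
      show "dist (modulus (circle_deriv f) t) (modulus (circle_deriv g) t) \<le> 2 * B + 2 * C"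
        using modulus_bounded[of "circle_deriv f" B t] modulus_bounded[of "circle_deriv g" C t] BC
        by (simp add: dist_real_def)
    qed
  qed
  have nonneg: "0 \<le> sup_dist UNIV f g"
    "0 \<le> sup_dist UNIV (circle_deriv f) (circle_deriv g)"
    "0 \<le> sup_dist {0..} (modulus (circle_deriv f)) (modulus (circle_deriv g))" for f g
    using deriv[of f g] modu[of f g] by (auto intro: sup_dist_nonneg circle_dist_le_1)
  show "0 \<le> dist_C1mod f g" for f g
    using nonneg[of f g] by (simp add: dist_C1mod_def dist_C1_def)
  show "dist_C1mod f g = dist_C1mod g f" for f g
    by (simp add: dist_C1mod_def dist_C1_def sup_dist_commute)
  show "dist_C1mod f g = 0 \<longleftrightarrow> f = g" for f g
  proof
    assume "dist_C1mod f g = 0"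
    then have "sup_dist UNIV f g = 0"
      using nonneg[of f g] by (simp add: dist_C1mod_def dist_C1_def)
    then have "dist (f \<theta>) (g \<theta>) \<le> 0" for \<theta>
      using sup_dist_upper[of UNIV f g 1 \<theta>] by (simp add: circle_dist_le_1)
    then show "f = g" by auto
  qed (simp add: dist_C1mod_def dist_C1_def sup_dist_def)
  fix f g h :: "circle \<Rightarrow> circle"
  have "sup_dist UNIV f h \<le> sup_dist UNIV f g + sup_dist UNIV g h"
    by (rule sup_dist_triangle[of _ _ _ 1 _ 1]) (auto intro: circle_dist_le_1)
  moreover have "sup_dist UNIV (circle_deriv f) (circle_deriv h)
      \<le> sup_dist UNIV (circle_deriv f) (circle_deriv g) + sup_dist UNIV (circle_deriv g) (circle_deriv h)"
    using deriv[of f g] deriv[of g h] by (auto intro: sup_dist_triangle)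
  moreover have "sup_dist {0..} (modulus (circle_deriv f)) (modulus (circle_deriv h))
      \<le> sup_dist {0..} (modulus (circle_deriv f)) (modulus (circle_deriv g))
        + sup_dist {0..} (modulus (circle_deriv g)) (modulus (circle_deriv h))"
    using modu[of f g] modu[of g h] by (auto intro: sup_dist_triangle)
  ultimately show "dist_C1mod f h \<le> dist_C1mod f g + dist_C1mod g h"
    by (simp add: dist_C1mod_def dist_C1_def)
qed

definition C1mod_topology :: "(circle \<Rightarrow> circle) topology" where
  "C1mod_topology = Metric_space.mtopology E1 dist_C1mod"

definition residual_in :: "'a topology \<Rightarrow> 'a set \<Rightarrow> bool" where
  "residual_in X A \<longleftrightarrow>
    (\<exists>U :: nat \<Rightarrow> 'a set.
      (\<forall>n. openin X (U n) \<and> X closure_of (U n) = topspace X) \<and> (\<Inter>n. U n) \<subseteq> A)"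

text \<open>The (open) arcs between consecutive points of \<open>f\<^sup>-\<^sup>n(p)\<close>. By continuity, the endpoints do not
  affect the suprema below.\<close>

definition injectivity_domains :: "(circle \<Rightarrow> circle) \<Rightarrow> circle \<Rightarrow> nat \<Rightarrow> circle set set" where
  "injectivity_domains f p n =
    {to_circle ` {a<..<b} | a b. a < b \<and>
       (f ^^ n) (to_circle a) = p \<and> (f ^^ n) (to_circle b) = p \<and>
       (\<forall>x\<in>{a<..<b}. (f ^^ n) (to_circle x) \<noteq> p)}"

definition distortion :: "(circle \<Rightarrow> circle) \<Rightarrow> circle \<Rightarrow> ereal" where
  "distortion f p =
    (SUP n\<in>{1..}. SUP I\<in>injectivity_domains f p n. SUP (x, y)\<in>I \<times> I.
       ereal (ln (circle_deriv (f ^^ n) x / circle_deriv (f ^^ n) y)))"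

text \<open>Finiteness of \<open>distortion f p\<close> does not depend on the fixed point \<open>p\<close>: an arc for one fixed
  point is covered by at most two adjacent closed arcs for another.\<close>

definition bounded_distortion :: "(circle \<Rightarrow> circle) \<Rightarrow> bool" where
  "bounded_distortion f \<longleftrightarrow> (\<forall>p. f p = p \<longrightarrow> distortion f p < \<infinity>)"

abbreviation unbounded_distortion :: "(circle \<Rightarrow> circle) \<Rightarrow> bool" where
  "unbounded_distortion f \<equiv> \<not> bounded_distortion f"

end

theory Submission
  imports Defs
begin

text \<open>
  A concave modulus \<open>h\<close> is its own modulus of continuity. If \<open>h (1/2) \<le> 1/2\<close>, there is an expanding
  map of degree 2 with fixed point 0 whose derivative at \<open>\<theta>\<close> is \<open>c + h (d (\<theta>, 0))\<close>, with a constant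
  \<open>c \<in> {3/2..2}\<close>. The modulus of continuity of this derivative is exactly \<open>h\<close> up to the diameter
  \<open>1/2\<close> (\<open>modulus_profile_map\<close>), and on maps of this form the metric \<open>dist_C1mod\<close> is at most five
  times the uniform distance of the profiles \<open>h\<close> (\<open>dist_C1mod_profile_map_le\<close>). The transversal
  \<open>\<Gamma>\<close> consists of such maps, which turns its construction into a choice of concave functions.

  If \<open>\<Sum>k. h ((2/5)\<^sup>k / 2)\<close> diverges, that is, if \<open>h\<close> violates Dini's condition, the map has unbounded
  distortion (\<open>unbounded_distortion_profile_map\<close>): on the injectivity domain adjacent to 0, the
  logarithm of the derivative of an iterate exceeds its value at 0 by a comparable sum, because
  the orbits leave 0 at most geometrically fast and the derivative is minimal at 0.

  Since \<open>\<Gamma>\<close> can be chosen, it suffices that it has an open dense subset \<open>U\<close> of maps of unbounded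
  distortion, and a countable \<open>U\<close> is enough. Every class contains a modulus \<open>h\<close> with
  \<open>h (1/2) = 1/2\<close>, and the set of these normalised moduli is separable
  (\<open>normalized_moduli_separable\<close>). Take a dense sequence in it and, for each of its members and each
  accuracy, a perturbation whose value at \<open>1/2\<close> is less than \<open>1/2\<close> and whose class is that of
  \<open>(2 - ln t) powr (- s)\<close>, with a new \<open>s \<in> {0<..1}\<close> for each perturbation
  (\<open>normalized_modulus_perturbation\<close>). These classes are pairwise distinct
  (\<open>log_modulus_inequivalent\<close>) and violate Dini's condition. The maps of the perturbations form \<open>U\<close>;
  every class that \<open>U\<close> does not meet is represented by a normalised modulus. Then \<open>U\<close> is dense in
  \<open>\<Gamma>\<close> by construction, and it is open in \<open>\<Gamma>\<close> because the modulus at \<open>1/2\<close> is continuous in the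
  map and is \<open>1/2\<close> exactly outside \<open>U\<close>.
\<close>

section \<open>Concave functions vanishing at the origin\<close>

lemma concave_scale_le:
  fixes h :: "real \<Rightarrow> real"
  assumes "concave_on S h" "h 0 = 0" "0 \<in> S" "x \<in> S" "0 \<le> l" "l \<le> 1"
  shows "l * h x \<le> h (l * x)"
  using concave_onD[OF assms(1,5,6,3,4)] assms(2) by simp

lemma concave_subadditive:
  fixes h :: "real \<Rightarrow> real"
  assumes "concave_on S h" "h 0 = 0" "0 \<in> S" "a + b \<in> S" "0 \<le> a" "0 \<le> b"
  shows "h (a + b) \<le> h a + h b"
proof (cases "a + b = 0")
  case True
  then show ?thesis using assms by (simp add: add_nonneg_eq_0_iff)
next
  case False
  then have pos: "0 < a + b" using assms(5,6) by linarith
  have "a / (a + b) * h (a + b) \<le> h (a / (a + b) * (a + b))"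
    using assms pos by (intro concave_scale_le[OF assms(1-4)]) auto
  moreover have "b / (a + b) * h (a + b) \<le> h (b / (a + b) * (a + b))"
    using assms pos by (intro concave_scale_le[OF assms(1-4)]) auto
  moreover have "a / (a + b) * h (a + b) + b / (a + b) * h (a + b) = h (a + b)"
    using pos by (simp flip: add_divide_distrib distrib_right)
  ultimately show ?thesis using pos by simp
qed

text \<open>Dropping the initial piece of a modulus and moving the rest back to the origin changes it
  by at most \<open>h \<delta>\<close>, and makes it Lipschitz since the slopes of a concave function decrease.\<close>

lemma concave_shift_Lipschitz:
  fixes h :: "real \<Rightarrow> real"
  assumes h: "concave_on {0..} h" "h 0 = 0" and "0 < \<delta>" "0 \<le> t"
  shows "h (t + \<delta>) - h \<delta> \<le> h \<delta> / \<delta> * t"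
proof -
  have "\<delta> / (t + \<delta>) * h (t + \<delta>) \<le> h (\<delta> / (t + \<delta>) * (t + \<delta>))"
    using assms(3,4) by (intro concave_scale_le[OF h]) auto
  also have "\<delta> / (t + \<delta>) * (t + \<delta>) = \<delta>" using assms(3,4) by simp
  finally have "\<delta> / (t + \<delta>) * h (t + \<delta>) \<le> h \<delta>" .
  then have "\<delta> * h (t + \<delta>) \<le> h \<delta> * (t + \<delta>)"
    using assms(3,4) by (simp add: field_simps)
  then show ?thesis using assms(3) by (simp add: field_simps)
qed

lemma concave_shift:
  fixes h :: "real \<Rightarrow> real"
  assumes h: "concave_on {0..} h" and "0 \<le> \<delta>"
  shows "concave_on {0..} (\<lambda>t. h (t + \<delta>) - h \<delta>)"
  unfolding concave_on_iff
proof (intro conjI ballI allI impI)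
  fix x y u v :: real
  assume xy: "x \<in> {0..}" "y \<in> {0..}" and uv: "0 \<le> u" "0 \<le> v" "u + v = 1"
  have "u * h (x + \<delta>) + v * h (y + \<delta>) \<le> h (u * (x + \<delta>) + v * (y + \<delta>))"
    using h xy uv assms(2) unfolding concave_on_iff by simp
  also have "u * (x + \<delta>) + v * (y + \<delta>) = u * x + v * y + (u + v) * \<delta>" by (simp add: algebra_simps)
  finally have "u * h (x + \<delta>) + v * h (y + \<delta>) \<le> h (u * x + v * y + \<delta>)" using uv by simp
  moreover have "u * h \<delta> + v * h \<delta> = h \<delta>" using uv by (simp flip: distrib_right)
  ultimately show "u * (h (x + \<delta>) - h \<delta>) + v * (h (y + \<delta>) - h \<delta>) \<le> h (u *\<^sub>R x + v *\<^sub>R y + \<delta>) - h \<delta>"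
    by (simp add: algebra_simps)
qed simp

text \<open>This serves for functions that are not differentiable at 0: away from 0 the second derivative
  decides concavity, and the chord inequality survives the limit of its left endpoint towards 0.\<close>

lemma concave_on_insert_0:
  fixes h :: "real \<Rightarrow> real"
  assumes conc: "concave_on {0<..b} h" and cont: "continuous_on {0..b} h"
  shows "concave_on {0..b} h"
proof (rule concave_on_linorderI)
  fix t x y :: real
  assume t: "0 < t" "t < 1" and xy: "x \<in> {0..b}" "y \<in> {0..b}" "x < y"
  show "(1 - t) * h x + t * h y \<le> h ((1 - t) *\<^sub>R x + t *\<^sub>R y)"
  proof (rule tendsto_le[of "at_right x"])
    show "at_right x \<noteq> bot" by simp
    have right: "(h \<longlongrightarrow> h x) (at_right x)"
      using xy continuous_on_subset[OF cont, of "{x..b}"]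
      by (intro continuous_on_Icc_at_rightD[of x b h]) auto
    show "((\<lambda>z. (1 - t) * h z + t * h y) \<longlongrightarrow> (1 - t) * h x + t * h y) (at_right x)"
      by (intro tendsto_intros right)
    have "(1 - t) * x + t * y > x"
      using t xy mult_strict_left_mono[of x y t] by (simp add: algebra_simps)
    moreover have "(1 - t) * x + t * y < y"
      using t xy mult_strict_left_mono[of x y "1 - t"] by (simp add: algebra_simps)
    ultimately have "(1 - t) * x + t * y \<in> interior {0..b}"
      using xy by auto
    then have "isCont h ((1 - t) * x + t * y)"
      using cont continuous_on_interior by blast
    then show "((\<lambda>z. h ((1 - t) *\<^sub>R z + t *\<^sub>R y)) \<longlongrightarrow> h ((1 - t) *\<^sub>R x + t *\<^sub>R y)) (at_right x)"
      unfolding real_scaleR_def by (rule isCont_tendsto_compose) (intro tendsto_intros)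
    have "eventually (\<lambda>z. z \<in> {x<..<y}) (at_right x)"
      using xy by (intro eventually_at_right_real) simp
    then show "eventually (\<lambda>z. (1 - t) * h z + t * h y \<le> h ((1 - t) *\<^sub>R z + t *\<^sub>R y)) (at_right x)"
    proof eventually_elim
      case (elim z)
      then show ?case using xy t by (intro concave_onD[OF conc]) auto
    qed
  qed
qed simp

section \<open>Logarithmic moduli\<close>

text \<open>For \<open>s \<in> {0<..1}\<close> these moduli are pairwise inequivalent and violate Dini's condition. The
  constant 2 makes them concave on \<open>{0..1}\<close>, hence up to the diameter \<open>1/2\<close> of the circle.\<close>

definition log_modulus :: "real \<Rightarrow> real \<Rightarrow> real" where
  "log_modulus s t = (if t \<le> 0 then 0 else (2 - ln t) powr (- s))"

lemma log_modulus_0 [simp]: "log_modulus s 0 = 0"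
  by (simp add: log_modulus_def)

lemma two_minus_ln_ge: "2 \<le> 2 - ln t" if "0 < t" "t \<le> 1" for t :: real
  using that ln_le_zero_iff[of t] by linarith

lemma log_modulus_pos: "0 < log_modulus s t" if "0 < t" "t \<le> 1"
proof -
  have "2 - ln t \<noteq> 0" using two_minus_ln_ge[OF that] by linarith
  then show ?thesis using that by (simp add: log_modulus_def)
qed

lemma log_modulus_mono: "log_modulus s t \<le> log_modulus s u" if "0 < s" "0 \<le> t" "t \<le> u" "u \<le> 1"
proof (cases "t = 0")
  case True
  then show ?thesis using that log_modulus_pos[of u s] by (cases "u = 0") auto
next
  case False
  then have "ln t \<le> ln u" "2 \<le> 2 - ln u" using that two_minus_ln_ge[of u] by auto
  then have "(2 - ln t) powr (- s) \<le> (2 - ln u) powr (- s)"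
    using that(1) by (intro powr_mono2') linarith+
  then show ?thesis using False that by (simp add: log_modulus_def)
qed

lemma log_modulus_less_1: "log_modulus s t < 1" if "0 < s" "0 \<le> t" "t \<le> 1"
proof (cases "t = 0")
  case False
  then have "1 < 2 - ln t" using that two_minus_ln_ge[of t] by linarith
  then have "(2 - ln t) powr (- s) < (2 - ln t) powr 0"
    using that by (intro powr_less_mono) auto
  then show ?thesis using False that \<open>1 < 2 - ln t\<close> by (simp add: log_modulus_def)
qed simp

lemma filterlim_two_minus_ln: "filterlim (\<lambda>t::real. 2 - ln t) at_top (at_right 0)"
proof -
  have "filterlim (\<lambda>t::real. - ln t) at_top (at_right 0)"
    unfolding filterlim_uminus_at_top minus_minus by (rule ln_at_0)
  from filterlim_tendsto_add_at_top[OF tendsto_const[of "2::real"] this]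
  show ?thesis by simp
qed

lemma log_power_tendsto_0: "((\<lambda>t. (2 - ln t) powr (- s)) \<longlongrightarrow> 0) (at_right (0::real))" if "0 < s"
  by (rule tendsto_neg_powr[OF _ filterlim_two_minus_ln]) (use that in simp)

lemma log_modulus_continuous: "continuous_on {0..1} (log_modulus s)" if "0 < s"
proof (rule continuous_on_IccI)
  show "(log_modulus s \<longlongrightarrow> log_modulus s 0) (at_right 0)"
    unfolding log_modulus_0
  proof (rule Lim_transform_eventually[OF log_power_tendsto_0[OF that]])
    show "\<forall>\<^sub>F t in at_right 0. (2 - ln t) powr (- s) = log_modulus s t"
      using eventually_at_right_less[of "0::real"] by eventually_elim (simp add: log_modulus_def)
  qed
next
  have cont: "isCont (log_modulus s) t" if "0 < t" "t \<le> 1" for t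
  proof -
    have "\<forall>\<^sub>F x in nhds t. (2 - ln x) powr (- s) = log_modulus s x"
      using eventually_nhds_in_open[of "{0<..}" t] that
      by (auto simp: log_modulus_def elim!: eventually_mono)
    moreover have "isCont (\<lambda>t. (2 - ln t) powr (- s)) t"
    proof -
      have "2 - ln t \<noteq> 0" using two_minus_ln_ge[OF that] by linarith
      then show ?thesis using that by (intro continuous_intros) auto
    qed
    ultimately show ?thesis using isCont_cong by fast
  qed
  show "(log_modulus s \<longlongrightarrow> log_modulus s 1) (at_left 1)"
    using cont[of 1] by (simp add: isCont_def filterlim_at_split)
  show "log_modulus s \<midarrow>t\<rightarrow> log_modulus s t" if "0 < t" "t < 1" for t
    using cont[of t] that by (simp add: isCont_def)
qed simp

text \<open>With \<open>L = 2 - ln t\<close>, the second derivative of \<open>L powr (-s)\<close> has the sign of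
  \<open>s + 1 - L\<close>, which is nonpositive as \<open>L \<ge> 2 \<ge> s + 1\<close>.\<close>

lemma log_modulus_concave:
  assumes "0 < s" "s \<le> 1" shows "concave_on {0..1} (log_modulus s)"
proof (rule concave_on_insert_0[OF _ log_modulus_continuous])
  have "concave_on {0<..1} (\<lambda>t. (2 - ln t) powr (- s))"
  proof (rule f''_le0_imp_concave)
    fix t :: real assume t: "t \<in> {0<..1}"
    then have L: "2 \<le> 2 - ln t" by (intro two_minus_ln_ge) auto
    have dL: "((\<lambda>t. 2 - ln t) has_real_derivative - (1 / t)) (at t)"
      using t by (auto intro!: derivative_eq_intros)
    have d: "((\<lambda>t. (2 - ln t) powr r) has_real_derivative - (r * (2 - ln t) powr (r - 1) / t)) (at t)"
      for r using DERIV_fun_powr[OF dL, of r] L by simp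
    show "((\<lambda>t. (2 - ln t) powr (- s)) has_real_derivative s * (2 - ln t) powr (- s - 1) / t) (at t)"
      using d[of "- s"] by simp
    have "((\<lambda>t. s * (2 - ln t) powr (- s - 1) / t) has_real_derivative
        (s * (- ((- s - 1) * (2 - ln t) powr (- s - 1 - 1) / t)) * t
          - s * (2 - ln t) powr (- s - 1) * 1) / (t * t)) (at t)"
      using t by (intro DERIV_divide DERIV_cmult d DERIV_ident) auto
    moreover have "(s * (- ((- s - 1) * Q / t)) * t - s * P * 1) / (t * t)
        = s * (s + 1) * Q / t\<^sup>2 - s * P / t\<^sup>2" for P Q
      using t by (simp add: power2_eq_square diff_divide_distrib algebra_simps)
    moreover have "- s - 1 - 1 = - s - 2" by simp
    ultimately show "((\<lambda>t. s * (2 - ln t) powr (- s - 1) / t) has_real_derivative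
        s * (s + 1) * (2 - ln t) powr (- s - 2) / t\<^sup>2 - s * (2 - ln t) powr (- s - 1) / t\<^sup>2) (at t)"
      by (simp only:)
    have "(s + 1) * (2 - ln t) powr (- s - 2) \<le> (2 - ln t) * (2 - ln t) powr (- s - 2)"
      using L assms by (intro mult_right_mono) auto
    also have "\<dots> = (2 - ln t) powr (1 + (- s - 2))"
      using L by (subst powr_add) simp
    also have "1 + (- s - 2) = - s - 1" by simp
    finally have "s * ((s + 1) * (2 - ln t) powr (- s - 2)) \<le> s * (2 - ln t) powr (- s - 1)"
      using assms by (intro mult_left_mono) auto
    then show "s * (s + 1) * (2 - ln t) powr (- s - 2) / t\<^sup>2 - s * (2 - ln t) powr (- s - 1) / t\<^sup>2 \<le> 0"
      by (simp add: divide_right_mono mult.assoc)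
  qed simp
  moreover have "log_modulus s t = (2 - ln t) powr (- s)" if "t \<in> {0<..1}" for t
    using that by (simp add: log_modulus_def)
  ultimately show "concave_on {0<..1} (log_modulus s)"
    unfolding concave_on_iff using convexD[of "{0<..1::real}"] by metis
qed (use assms in simp)

section \<open>Circle maps with a concave profile\<close>

lemma circle_dist_le_half: "dist (\<theta> :: circle) \<phi> \<le> 1/2"
proof -
  obtain x y where "\<theta> = to_circle x" "\<phi> = to_circle y" by (meson to_circle_cases)
  then show ?thesis
    using of_int_round_abs_le[of "x - y"] by (simp add: dist_to_circle_round abs_minus_commute)
qed

lemma dist_to_circle_0:
  assumes "0 \<le> x" "x \<le> 1/2" shows "dist (to_circle x) (to_circle 0) = x"
proof -
  have "x \<le> \<bar>x - of_int n\<bar>" for n :: int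
  proof (cases "n \<le> 0")
    case False
    then have "1 \<le> real_of_int n" by linarith
    then show ?thesis using assms by linarith
  qed (use assms in auto)
  then have "x \<le> dist (to_circle x) (to_circle 0)" by (simp add: dist_to_circle_round)
  moreover have "dist (to_circle x) (to_circle 0) \<le> x"
    using dist_to_circle_le[of x 0 0] assms by simp
  ultimately show ?thesis by simp
qed

lemma to_circle_circle_rep [simp]: "to_circle (circle_rep \<theta>) = \<theta>"
  using Quotient_circle by (rule Quotient_abs_rep)

lemma to_circle_frac: obtains x where "\<theta> = to_circle x" "0 \<le> x" "x < 1"
proof -
  obtain x where x: "\<theta> = to_circle x" by (rule to_circle_cases)
  then have "\<theta> = to_circle (frac x)" by (simp add: to_circle_eq_iff frac_def)
  then show ?thesis using that[of "frac x"] frac_lt_1[of x] by simp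
qed

lemma C1_liftI:
  assumes "\<And>x. (F has_real_derivative D x) (at x)" "continuous_on UNIV D"
    "\<And>x. to_circle (F x) = f (to_circle x)"
  shows "C1_lift f F"
  using assms unfolding C1_lift_def C1_differentiable_on_def
  by (auto simp flip: has_real_derivative_iff_has_vector_derivative intro!: exI[of _ D])

text \<open>A profile is the restriction of a concave modulus to the distances that occur on the circle.
  The bound \<open>1/2\<close> makes the derivatives of the maps below at least \<open>3/2\<close>.\<close>

definition profiles :: "(real \<Rightarrow> real) set" where
  "profiles = {h. continuous_on {0..1/2} h \<and> mono_on {0..1/2} h \<and> concave_on {0..1/2} h \<and>
     h 0 = 0 \<and> h (1/2) \<le> 1/2}"

lemma profile_bounds:
  assumes "h \<in> profiles" "0 \<le> t" "t \<le> 1/2" shows "0 \<le> h t" "h t \<le> 1/2"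
proof -
  have mono: "mono_on {0..1/2} h" and h: "h 0 = 0" "h (1/2) \<le> 1/2"
    using assms(1) by (auto simp: profiles_def)
  show "0 \<le> h t" using mono_onD[OF mono, of 0 t] assms h by simp
  show "h t \<le> 1/2" using mono_onD[OF mono, of t "1/2"] assms h by simp
qed

text \<open>A profile \<open>h\<close> gives the circle map of degree 2 that fixes 0 and whose derivative is a constant
  plus \<open>h\<close> of the distance to 0; the degree determines the constant, \<open>profile_slope h\<close>.\<close>

definition radial :: "(real \<Rightarrow> real) \<Rightarrow> real \<Rightarrow> real" where
  "radial h x = h (dist (to_circle x) (to_circle 0))"

definition radial_primitive :: "(real \<Rightarrow> real) \<Rightarrow> real \<Rightarrow> real" where
  "radial_primitive h = (SOME P. P 0 = 0 \<and> (\<forall>x. (P has_real_derivative radial h x) (at x)))"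

definition profile_slope :: "(real \<Rightarrow> real) \<Rightarrow> real" where
  "profile_slope h = 2 - radial_primitive h 1"

definition profile_lift :: "(real \<Rightarrow> real) \<Rightarrow> real \<Rightarrow> real" where
  "profile_lift h x = profile_slope h * x + radial_primitive h x"

definition profile_map :: "(real \<Rightarrow> real) \<Rightarrow> circle \<Rightarrow> circle" where
  "profile_map h \<theta> = to_circle (profile_lift h (circle_rep \<theta>))"

lemma radial_bounds: "0 \<le> radial h x" "radial h x \<le> 1/2" if "h \<in> profiles"
  using profile_bounds[OF that] circle_dist_le_half by (auto simp: radial_def)

lemma radial_add_1: "radial h (x + 1) = radial h x"
proof -
  have "to_circle (x + 1) = to_circle x" by (simp add: to_circle_eq_iff)
  then show ?thesis by (simp add: radial_def)
qed

lemma continuous_on_radial: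
  assumes "h \<in> profiles" shows "continuous_on UNIV (radial h)"
proof -
  have "1-lipschitz_on UNIV (\<lambda>x. dist (to_circle x) (to_circle 0))"
  proof (rule lipschitz_onI)
    fix x y :: real
    have "dist (dist (to_circle x) (to_circle 0)) (dist (to_circle y) (to_circle 0))
        \<le> dist (to_circle x) (to_circle y)"
      by (simp add: dist_real_def abs_le_iff) (metis add.commute dist_commute dist_triangle le_diff_eq diff_le_eq)
    also have "\<dots> \<le> 1 * dist x y"
      using dist_to_circle_le[of x y 0] by (simp add: dist_real_def)
    finally show "dist (dist (to_circle x) (to_circle 0)) (dist (to_circle y) (to_circle 0)) \<le> 1 * dist x y" .
  qed simp
  then have dist: "continuous_on UNIV (\<lambda>x. dist (to_circle x) (to_circle 0))"
    by (rule lipschitz_on_continuous_on)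
  have "continuous_on {0..1/2} h" using assms by (simp add: profiles_def)
  then show ?thesis unfolding radial_def
    by (rule continuous_on_compose2[OF _ dist]) (use circle_dist_le_half in auto)
qed

lemma radial_primitive:
  assumes "h \<in> profiles"
  shows "radial_primitive h 0 = 0" "(radial_primitive h has_real_derivative radial h x) (at x)"
proof -
  have "\<exists>P. \<forall>x::real. - \<infinity> < ereal x \<longrightarrow> ereal x < \<infinity> \<longrightarrow> (P has_vector_derivative radial h x) (at x)"
    using continuous_on_radial[OF assms]
    by (intro einterval_antiderivative) (auto simp: continuous_on_eq_continuous_at)
  then obtain P where P: "\<And>x. (P has_real_derivative radial h x) (at x)"
    by (auto simp: has_real_derivative_iff_has_vector_derivative)
  have "((\<lambda>x. P x - P 0) has_real_derivative radial h x) (at x)" for x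
    using DERIV_diff[OF P DERIV_const] by simp
  then have "\<exists>P. P 0 = 0 \<and> (\<forall>x. (P has_real_derivative radial h x) (at x))"
    by (intro exI[of _ "\<lambda>x. P x - P 0"]) simp
  from someI_ex[OF this]
  show "radial_primitive h 0 = 0" "(radial_primitive h has_real_derivative radial h x) (at x)"
    unfolding radial_primitive_def by blast+
qed

lemma profile_slope_bounds:
  assumes "h \<in> profiles" shows "3/2 \<le> profile_slope h" "profile_slope h \<le> 2"
proof -
  obtain z where "radial_primitive h 1 - radial_primitive h 0 = (1 - 0) * radial h z"
    using MVT2[of 0 1 "radial_primitive h" "radial h"] radial_primitive(2)[OF assms] by auto
  then show "3/2 \<le> profile_slope h" "profile_slope h \<le> 2"
    using radial_bounds[OF assms, of z] radial_primitive(1)[OF assms] by (auto simp: profile_slope_def)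
qed

lemma profile_lift_has_derivative:
  assumes "h \<in> profiles"
  shows "(profile_lift h has_real_derivative profile_slope h + radial h x) (at x)"
  unfolding profile_lift_def
  by (auto intro!: derivative_eq_intros radial_primitive(2)[OF assms])

lemma profile_lift_0: "profile_lift h 0 = 0" if "h \<in> profiles"
  using radial_primitive(1)[OF that] by (simp add: profile_lift_def)

lemma profile_lift_1: "profile_lift h 1 = 2"
  by (simp add: profile_lift_def profile_slope_def)

lemma profile_lift_add_1:
  assumes "h \<in> profiles" shows "profile_lift h (x + 1) = profile_lift h x + 2"
proof -
  have "((\<lambda>x. profile_lift h (x + 1) - profile_lift h x) has_real_derivative 0) (at x)" for x
  proof -
    have "((\<lambda>x. profile_lift h (x + 1)) has_real_derivative profile_slope h + radial h x) (at x)"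
      using profile_lift_has_derivative[OF assms, of "x + 1"] by (simp add: DERIV_shift radial_add_1)
    from DERIV_diff[OF this profile_lift_has_derivative[OF assms, of x]] show ?thesis by simp
  qed
  then have "profile_lift h (x + 1) - profile_lift h x = profile_lift h (0 + 1) - profile_lift h 0"
    using DERIV_isconst_all by blast
  then show ?thesis using profile_lift_0[OF assms] profile_lift_1[of h] by simp
qed

lemma profile_lift_add_of_int:
  assumes "h \<in> profiles" shows "profile_lift h (x + of_int k) = profile_lift h x + 2 * of_int k"
proof (induction k rule: int_induct[where k = 0])
  case (step1 i)
  then show ?case using profile_lift_add_1[OF assms, of "x + of_int i"] by (simp add: algebra_simps)
next
  case (step2 i)
  then show ?case using profile_lift_add_1[OF assms, of "x + of_int (i - 1)"] by (simp add: algebra_simps)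
qed simp

lemma C1_lift_profile_map:
  assumes "h \<in> profiles" shows "C1_lift (profile_map h) (profile_lift h)"
proof (rule C1_liftI)
  show "(profile_lift h has_real_derivative profile_slope h + radial h x) (at x)" for x
    by (rule profile_lift_has_derivative[OF assms])
  show "continuous_on UNIV (\<lambda>x. profile_slope h + radial h x)"
    by (intro continuous_intros continuous_on_radial[OF assms])
  fix x
  have "to_circle (circle_rep (to_circle x)) = to_circle x" by simp
  then obtain k :: int where "circle_rep (to_circle x) = x + of_int k"
    unfolding to_circle_eq_iff by (metis Ints_cases add.commute diff_add_cancel)
  then show "to_circle (profile_lift h x) = profile_map h (to_circle x)"
    by (simp add: profile_map_def profile_lift_add_of_int[OF assms] to_circle_eq_iff)
qed

lemma circle_deriv_profile_map:
  assumes "h \<in> profiles"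
  shows "circle_deriv (profile_map h) \<theta> = profile_slope h + h (dist \<theta> (to_circle 0))"
proof -
  obtain x where x: "\<theta> = to_circle x" by (rule to_circle_cases)
  have "deriv (profile_lift h) x = profile_slope h + radial h x"
    using profile_lift_has_derivative[OF assms] by (rule DERIV_imp_deriv)
  then show ?thesis
    using circle_deriv_eq[OF C1_lift_profile_map[OF assms], of x] by (simp add: x radial_def)
qed

lemma profile_map_in_E1:
  assumes "h \<in> profiles" shows "profile_map h \<in> E1"
proof -
  have "3/2 \<le> \<bar>circle_deriv (profile_map h) \<theta>\<bar>" for \<theta>
    using profile_slope_bounds[OF assms] profile_bounds(1)[OF assms, of "dist \<theta> (to_circle 0)"]
      circle_dist_le_half[of \<theta> "to_circle 0"]
    by (simp add: circle_deriv_profile_map[OF assms])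
  then have "3/2 \<le> (INF \<theta>. \<bar>circle_deriv (profile_map h) \<theta>\<bar>)" by (intro cINF_greatest) auto
  moreover have "C1_map (profile_map h)"
    using C1_lift_profile_map[OF assms] by (auto simp: C1_map_def)
  ultimately show ?thesis by (simp add: E1_def)
qed

text \<open>By subadditivity a concave modulus is its own modulus of continuity. Composition with the
  1-Lipschitz distance to 0 preserves the upper bound, and the points of an arc issuing from 0
  approach it, so the profile is recovered exactly from the map.\<close>

lemma modulus_profile_map:
  assumes h: "h \<in> profiles" and "0 < t"
  shows "modulus (circle_deriv (profile_map h)) t = h (min t (1/2))"
proof -
  let ?D = "circle_deriv (profile_map h)" and ?o = "to_circle 0"
  let ?S = "{\<bar>?D x - ?D y\<bar> | x y. dist x y < t}"
  have mono: "mono_on {0..1/2} h" and conc: "concave_on {0..1/2} h"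
    and cont: "continuous_on {0..1/2} h" and h0: "h 0 = 0"
    using h by (auto simp: profiles_def)
  have *: "\<bar>?D x - ?D y\<bar> \<le> h (min t (1/2))" if "dist x ?o \<le> dist y ?o" "dist x y < t" for x y
  proof -
    let ?a = "dist x ?o" and ?b = "dist y ?o"
    have b: "?b \<le> 1/2" by (rule circle_dist_le_half)
    have ab: "0 \<le> ?b - ?a" "?b - ?a \<le> min t (1/2)"
      using that b dist_triangle[of y ?o x] by (auto simp: dist_commute) (smt (verit) zero_le_dist)
    have "h ?b \<le> h ?a + h (?b - ?a)"
      using concave_subadditive[OF conc h0, of ?a "?b - ?a"] b ab by simp
    moreover have "h ?a \<le> h ?b" using mono_onD[OF mono, of ?a ?b] b that by auto
    moreover have "h (?b - ?a) \<le> h (min t (1/2))"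
      using ab \<open>0 < t\<close> by (intro mono_onD[OF mono]) auto
    ultimately show ?thesis by (simp add: circle_deriv_profile_map[OF h])
  qed
  have upper: "s \<le> h (min t (1/2))" if "s \<in> ?S" for s
  proof -
    from that obtain x y where "s = \<bar>?D x - ?D y\<bar>" "dist x y < t" by blast
    then show ?thesis using *[of x y] *[of y x] by (metis abs_minus_commute dist_commute linear)
  qed
  have lower: "h s \<le> Sup ?S" if s: "0 \<le> s" "s < t" "s \<le> 1/2" for s
  proof (rule cSup_upper)
    have "\<bar>?D (to_circle s) - ?D ?o\<bar> = h s"
      using profile_bounds[OF h s(1,3)] s h0
      by (simp add: circle_deriv_profile_map[OF h] dist_to_circle_0)
    moreover have "dist (to_circle s) ?o < t" using s by (simp add: dist_to_circle_0)
    ultimately show "h s \<in> ?S" by force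
    show "bdd_above ?S" using upper by (rule bdd_aboveI)
  qed
  have "h (min t (1/2)) \<le> Sup ?S"
  proof (cases "1/2 < t")
    case True
    then show ?thesis using lower[of "1/2"] by (simp add: min_def)
  next
    case False
    have "(h \<longlongrightarrow> h t) (at_left t)"
      using continuous_on_subset[OF cont, of "{0..t}"] False \<open>0 < t\<close>
      by (intro continuous_on_Icc_at_leftD[of 0 t h]) auto
    moreover have "eventually (\<lambda>s. h s \<le> Sup ?S) (at_left t)"
      using eventually_at_left_real[OF \<open>0 < t\<close>]
      by eventually_elim (use False lower in auto)
    ultimately have "h t \<le> Sup ?S" by (intro tendsto_upperbound) auto
    then show ?thesis using False by (simp add: min_def)
  qed
  moreover have "dist ?o ?o < t" using \<open>0 < t\<close> by simp
  then have "?S \<noteq> {}" by blast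
  then have "Sup ?S \<le> h (min t (1/2))" using upper by (rule cSup_least)
  ultimately show ?thesis using \<open>0 < t\<close> by (simp add: modulus_def)
qed

lemma sup_dist_le:
  assumes "A \<noteq> {}" "\<And>x. x \<in> A \<Longrightarrow> dist (u x) (v x) \<le> B" shows "sup_dist A u v \<le> B"
  unfolding sup_dist_def using assms by (rule cSUP_least)

text \<open>As the map, its derivative and the modulus of its derivative are explicit in the profile, each
  part of the metric is controlled by the uniform distance of the profiles. Approximation of
  maps thereby becomes approximation of concave functions.\<close>

lemma dist_C1mod_profile_map_le:
  assumes h: "h \<in> profiles" and k: "k \<in> profiles"
    and e: "\<And>t. 0 \<le> t \<Longrightarrow> t \<le> 1/2 \<Longrightarrow> \<bar>h t - k t\<bar> \<le> e"
  shows "dist_C1mod (profile_map h) (profile_map k) \<le> 5 * e"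
proof -
  have e0: "0 \<le> e" using e[of 0] by linarith
  have prim: "\<bar>radial_primitive h x - radial_primitive k x\<bar> \<le> e" if "0 \<le> x" "x \<le> 1" for x
  proof (cases "x = 0")
    case True
    then show ?thesis using e0 radial_primitive(1)[OF h] radial_primitive(1)[OF k] by simp
  next
    case False
    have "((\<lambda>x. radial_primitive h x - radial_primitive k x) has_real_derivative
        radial h y - radial k y) (at y)" for y
      using h k by (intro DERIV_diff radial_primitive(2))
    moreover have "0 < x" using False that by simp
    ultimately obtain z where z: "(radial_primitive h x - radial_primitive k x)
        - (radial_primitive h 0 - radial_primitive k 0) = (x - 0) * (radial h z - radial k z)"
      using MVT2[of 0 x "\<lambda>x. radial_primitive h x - radial_primitive k x"
          "\<lambda>x. radial h x - radial k x"] by metis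
    have "\<bar>radial_primitive h x - radial_primitive k x\<bar> = x * \<bar>radial h z - radial k z\<bar>"
      using z that radial_primitive(1)[OF h] radial_primitive(1)[OF k] by (simp add: abs_mult)
    also have "\<dots> \<le> 1 * e"
      using that e circle_dist_le_half by (intro mult_mono) (auto simp: radial_def)
    finally show ?thesis by simp
  qed
  have slope: "\<bar>profile_slope h - profile_slope k\<bar> \<le> e"
    using prim[of 1] by (simp add: profile_slope_def abs_minus_commute)
  have "sup_dist UNIV (profile_map h) (profile_map k) \<le> 2 * e"
  proof (rule sup_dist_le)
    fix \<theta>
    obtain x where x: "\<theta> = to_circle x" "0 \<le> x" "x < 1" by (rule to_circle_frac)
    have "dist (profile_map h \<theta>) (profile_map k \<theta>) = dist (to_circle (profile_lift h x)) (to_circle (profile_lift k x))"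
      using C1_lift_profile_map[OF h] C1_lift_profile_map[OF k] by (simp add: x C1_lift_def)
    also have "\<dots> \<le> \<bar>profile_lift h x - profile_lift k x\<bar>"
      using dist_to_circle_le[of _ _ 0] by simp
    also have "\<dots> = \<bar>(profile_slope h - profile_slope k) * x + (radial_primitive h x - radial_primitive k x)\<bar>"
      by (simp add: profile_lift_def algebra_simps)
    also have "\<dots> \<le> \<bar>profile_slope h - profile_slope k\<bar> * x + \<bar>radial_primitive h x - radial_primitive k x\<bar>"
      using x by (intro order_trans[OF abs_triangle_ineq]) (simp add: abs_mult)
    also have "\<dots> \<le> e * 1 + e"
      using slope prim[of x] x e0 by (intro add_mono mult_mono) auto
    finally show "dist (profile_map h \<theta>) (profile_map k \<theta>) \<le> 2 * e" by simp
  qed simp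
  moreover have "sup_dist UNIV (circle_deriv (profile_map h)) (circle_deriv (profile_map k)) \<le> 2 * e"
  proof (rule sup_dist_le)
    fix \<theta>
    show "dist (circle_deriv (profile_map h) \<theta>) (circle_deriv (profile_map k) \<theta>) \<le> 2 * e"
      using slope e[of "dist \<theta> (to_circle 0)"] circle_dist_le_half[of \<theta> "to_circle 0"]
      by (simp add: circle_deriv_profile_map[OF h] circle_deriv_profile_map[OF k] dist_real_def)
  qed simp
  moreover have "sup_dist {0..} (modulus (circle_deriv (profile_map h))) (modulus (circle_deriv (profile_map k))) \<le> e"
  proof (rule sup_dist_le)
    fix t :: real assume "t \<in> {0..}"
    then show "dist (modulus (circle_deriv (profile_map h)) t) (modulus (circle_deriv (profile_map k)) t) \<le> e"
      using e[of "min t (1/2)"] e0 modulus_profile_map[OF h, of t] modulus_profile_map[OF k, of t]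
      by (cases "t = 0") (auto simp: modulus_def dist_real_def)
  qed simp
  ultimately show ?thesis by (simp add: dist_C1mod_def dist_C1_def)
qed

section \<open>Failure of Dini's condition forces unbounded distortion\<close>

text \<open>The derivative of the \<open>n\<close>-th iterate of the lift, by the chain rule.\<close>

definition orbit_deriv :: "(real \<Rightarrow> real) \<Rightarrow> nat \<Rightarrow> real \<Rightarrow> real" where
  "orbit_deriv h n x = (\<Prod>j<n. profile_slope h + radial h ((profile_lift h ^^ j) x))"

lemma funpow_profile_lift_has_derivative:
  assumes "h \<in> profiles"
  shows "((profile_lift h ^^ n) has_real_derivative orbit_deriv h n x) (at x)"
proof (induction n)
  case (Suc n)
  from DERIV_chain[OF profile_lift_has_derivative[OF assms] Suc]
  show ?case by (simp add: orbit_deriv_def o_def mult.commute)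
qed (simp add: orbit_deriv_def id_def)

lemma continuous_on_funpow_profile_lift:
  "continuous_on UNIV (profile_lift h ^^ n)" if "h \<in> profiles"
  by (rule DERIV_continuous_on) (rule funpow_profile_lift_has_derivative[OF that])

lemma continuous_on_orbit_deriv:
  assumes "h \<in> profiles" shows "continuous_on UNIV (orbit_deriv h n)"
proof -
  have "continuous_on UNIV (\<lambda>x. radial h ((profile_lift h ^^ j) x))" for j
    by (rule continuous_on_compose2[OF continuous_on_radial[OF assms]
          continuous_on_funpow_profile_lift[OF assms]]) simp
  then show ?thesis
    unfolding orbit_deriv_def by (intro continuous_intros)
qed

lemma orbit_deriv_pos: "0 < orbit_deriv h n x" if "h \<in> profiles"
  unfolding orbit_deriv_def
  using profile_slope_bounds[OF that] radial_bounds[OF that]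
  by (intro prod_pos) (auto intro!: add_pos_nonneg)

lemma funpow_profile_map: "(profile_map h ^^ n) (to_circle x) = to_circle ((profile_lift h ^^ n) x)"
  if "h \<in> profiles"
  using C1_lift_profile_map[OF that] by (induction n) (auto simp: C1_lift_def)

lemma circle_deriv_funpow_profile_map:
  assumes "h \<in> profiles"
  shows "circle_deriv (profile_map h ^^ n) (to_circle x) = orbit_deriv h n x"
proof -
  have "C1_lift (profile_map h ^^ n) (profile_lift h ^^ n)"
    using funpow_profile_lift_has_derivative[OF assms] continuous_on_orbit_deriv[OF assms]
    by (rule C1_liftI) (simp add: funpow_profile_map[OF assms])
  then show ?thesis
    using circle_deriv_eq DERIV_imp_deriv[OF funpow_profile_lift_has_derivative[OF assms]] by simp
qed

lemma funpow_profile_lift_strict_mono: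
  assumes "h \<in> profiles" "x < y" shows "(profile_lift h ^^ n) x < (profile_lift h ^^ n) y"
  using funpow_profile_lift_has_derivative[OF assms(1)] orbit_deriv_pos[OF assms(1)] assms(2)
  by (metis DERIV_pos_imp_increasing)

lemma funpow_profile_lift_0: "(profile_lift h ^^ n) 0 = 0" if "h \<in> profiles"
  using profile_lift_0[OF that] by (induction n) auto

lemma profile_lift_growth:
  assumes "h \<in> profiles" "0 \<le> x"
  shows "x \<le> profile_lift h x" "profile_lift h x \<le> 5/2 * x"
proof -
  have "x \<le> profile_lift h x \<and> profile_lift h x \<le> 5/2 * x"
  proof (cases "x = 0")
    case False
    then have "0 < x" using assms(2) by simp
    from MVT2[OF this profile_lift_has_derivative[OF assms(1)]]
    obtain z where "profile_lift h x - profile_lift h 0 = (x - 0) * (profile_slope h + radial h z)"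
      by blast
    then have "profile_lift h x = (profile_slope h + radial h z) * x"
      using profile_lift_0[OF assms(1)] by simp
    moreover have "1 * x \<le> (profile_slope h + radial h z) * x"
      using profile_slope_bounds[OF assms(1)] radial_bounds[OF assms(1), of z] assms(2)
      by (intro mult_right_mono) auto
    moreover have "(profile_slope h + radial h z) * x \<le> 5/2 * x"
      using profile_slope_bounds[OF assms(1)] radial_bounds[OF assms(1), of z] assms(2)
      by (intro mult_right_mono) auto
    ultimately show ?thesis by simp
  qed (use profile_lift_0[OF assms(1)] in simp)
  then show "x \<le> profile_lift h x" "profile_lift h x \<le> 5/2 * x" by auto
qed

lemma funpow_profile_lift_growth:
  assumes "h \<in> profiles" "0 \<le> x"
  shows "x \<le> (profile_lift h ^^ n) x \<and> (profile_lift h ^^ n) x \<le> (5/2) ^ n * x"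
proof (induction n)
  case (Suc n)
  let ?y = "(profile_lift h ^^ n) x"
  have "0 \<le> ?y" using Suc assms(2) by linarith
  then have "?y \<le> profile_lift h ?y" "profile_lift h ?y \<le> 5/2 * ?y"
    using profile_lift_growth[OF assms(1)] by auto
  moreover have "5/2 * ?y \<le> 5/2 * ((5/2) ^ n * x)" using Suc by (intro mult_left_mono) auto
  ultimately show ?case using Suc by (simp add: mult.assoc)
qed simp

lemma funpow_profile_lift_hits:
  assumes "h \<in> profiles" "0 < v" "v \<le> 1"
  obtains x where "0 < x" "(profile_lift h ^^ n) x = v"
proof -
  have "\<exists>x\<ge>0. x \<le> 1 \<and> (profile_lift h ^^ n) x = v"
    using funpow_profile_lift_growth[OF assms(1), of 1 n] funpow_profile_lift_0[OF assms(1), of n] assms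
      continuous_on_subset[OF continuous_on_funpow_profile_lift[OF assms(1), of n], of "{0..1}"]
    by (intro IVT') auto
  then obtain x where "0 \<le> x" "(profile_lift h ^^ n) x = v" by blast
  then show ?thesis
    using that[of x] funpow_profile_lift_0[OF assms(1), of n] assms(2) by (cases "x = 0") auto
qed

text \<open>The arc starts at the fixed point 0 and ends where the lifted iterate, being increasing, first
  reaches the next integer.\<close>

lemma injectivity_domain_at_0:
  assumes h: "h \<in> profiles" and b: "0 < b" "(profile_lift h ^^ n) b = 1"
  shows "to_circle ` {0<..<b} \<in> injectivity_domains (profile_map h) (to_circle 0) n"
proof -
  have "to_circle ((profile_lift h ^^ n) x) \<noteq> to_circle 0" if "x \<in> {0<..<b}" for x
  proof
    assume "to_circle ((profile_lift h ^^ n) x) = to_circle 0"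
    then have "(profile_lift h ^^ n) x \<in> \<int>" by (simp add: to_circle_eq_iff)
    moreover have "0 < (profile_lift h ^^ n) x" "(profile_lift h ^^ n) x < 1"
      using funpow_profile_lift_strict_mono[OF h, of 0 x n] funpow_profile_lift_strict_mono[OF h, of x b n]
        funpow_profile_lift_0[OF h, of n] b that by auto
    ultimately show False by (auto elim!: Ints_cases)
  qed
  moreover have "to_circle 1 = to_circle 0" by (simp add: to_circle_eq_iff)
  ultimately show ?thesis
    unfolding injectivity_domains_def mem_Collect_eq funpow_profile_map[OF h]
    using b funpow_profile_lift_0[OF h, of n] by (intro exI[of _ 0] exI[of _ b]) auto
qed

lemma distortion_at_0_ge:
  assumes h: "h \<in> profiles" and "1 \<le> n" and b: "(profile_lift h ^^ n) b = 1"
    and xy: "0 < x" "x < b" "0 < y" "y < b"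
  shows "ereal (ln (orbit_deriv h n x / orbit_deriv h n y)) \<le> distortion (profile_map h) (to_circle 0)"
proof -
  let ?I = "to_circle ` {0<..<b}"
  have "ereal (ln (circle_deriv (profile_map h ^^ n) (to_circle x)
        / circle_deriv (profile_map h ^^ n) (to_circle y)))
      \<le> distortion (profile_map h) (to_circle 0)"
    unfolding distortion_def
    using assms injectivity_domain_at_0[OF h _ b]
    by (intro SUP_upper2[of n] SUP_upper2[of ?I] SUP_upper2[of "(to_circle x, to_circle y)"]) auto
  then show ?thesis by (simp add: circle_deriv_funpow_profile_map[OF h])
qed

text \<open>Let \<open>x\<close> be the point of the domain at 0 that the \<open>n\<close>-th iterate maps to \<open>1/2\<close>. As the map
  expands by at most \<open>5/2\<close>, the \<open>n - k\<close>-th iterate of \<open>x\<close> has distance at least \<open>(2/5)\<^sup>k / 2\<close> from 0,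
  so it contributes a factor of at least \<open>1 + h ((2/5)\<^sup>k / 2) / 2\<close> to the ratio of the
  derivatives of the \<open>n\<close>-th iterate at \<open>x\<close> and at 0. The product of these factors exceeds the sum
  of the summands \<open>h ((2/5)\<^sup>k / 2) / 2\<close>.\<close>

lemma orbit_deriv_ratio_ge:
  assumes h: "h \<in> profiles" and x: "0 < x" "(profile_lift h ^^ n) x = 1/2"
  shows "(\<Sum>k<n. h ((2/5) ^ Suc k / 2)) / 2 \<le> orbit_deriv h n x / orbit_deriv h n 0"
proof -
  let ?y = "\<lambda>j. (profile_lift h ^^ j) x" and ?c = "profile_slope h"
  have h0: "h 0 = 0" and mono: "mono_on {0..1/2} h" using h by (auto simp: profiles_def)
  have c: "0 < ?c" "?c \<le> 2" using profile_slope_bounds[OF h] by auto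
  have ratio: "h ((2/5) ^ Suc (n - Suc j) / 2) / 2 \<le> radial h (?y j) / ?c" if "j < n" for j
  proof -
    let ?k = "Suc (n - Suc j)"
    have k: "n = ?k + j" using that by simp
    have "(profile_lift h ^^ ?k) (?y j) = 1/2"
      using x(2) by (subst (asm) k) (simp only: funpow_add o_apply)
    moreover have y0: "0 \<le> ?y j"
      using funpow_profile_lift_growth[OF h, of x j] x by linarith
    ultimately have y: "?y j \<le> 1/2" "1/2 \<le> (5/2) ^ ?k * ?y j"
      using funpow_profile_lift_growth[OF h y0, of ?k] by auto
    have "(2/5) ^ ?k / 2 \<le> (2/5) ^ ?k * ((5/2) ^ ?k * ?y j)"
      using mult_left_mono[OF y(2), of "(2/5) ^ ?k"] by simp
    also have "\<dots> = ((2/5) * (5/2)) ^ ?k * ?y j" by (simp only: power_mult_distrib mult.assoc)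
    also have "\<dots> = ?y j" by simp
    finally have "h ((2/5) ^ ?k / 2) \<le> h (?y j)"
      using y y0 by (intro mono_onD[OF mono]) auto
    also have "h (?y j) = radial h (?y j)" using y y0 by (simp add: radial_def dist_to_circle_0)
    finally have "h ((2/5) ^ ?k / 2) / 2 \<le> radial h (?y j) / 2" by simp
    also have "\<dots> \<le> radial h (?y j) / ?c"
      using c radial_bounds[OF h] by (intro divide_left_mono) auto
    finally show ?thesis .
  qed
  have "(\<Sum>k<n. h ((2/5) ^ Suc k / 2)) / 2 = (\<Sum>k<n. h ((2/5) ^ Suc k / 2) / 2)"
    by (rule sum_divide_distrib)
  also have "\<dots> = (\<Sum>j<n. h ((2/5) ^ Suc (n - Suc j) / 2) / 2)"
    by (rule sum.nat_diff_reindex[symmetric])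
  also have "\<dots> \<le> (\<Sum>j<n. radial h (?y j) / ?c)"
    using ratio by (intro sum_mono) auto
  also have "\<dots> \<le> (\<Prod>j<n. 1 + radial h (?y j) / ?c)"
    using c radial_bounds[OF h] by (intro sum_le_prod) auto
  also have "\<dots> = (\<Prod>j<n. (?c + radial h (?y j)) / ?c)"
    using c by (intro prod.cong) (auto simp: add_divide_distrib)
  also have "\<dots> = orbit_deriv h n x / orbit_deriv h n 0"
    using h0 by (simp add: orbit_deriv_def prod_dividef funpow_profile_lift_0[OF h] radial_def)
  finally show ?thesis .
qed

text \<open>A bound on the distortion would bound the ratios of \<open>orbit_deriv_ratio_ge\<close>, and with them
  the partial sums of the series. The point 0 is an endpoint of the open arcs in the definition
  of distortion, so it is approached by interior points.\<close>

theorem unbounded_distortion_profile_map: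
  assumes h: "h \<in> profiles" and "\<not> summable (\<lambda>k. h ((2/5) ^ k / 2))"
  shows "unbounded_distortion (profile_map h)"
proof
  let ?p = "to_circle 0"
  assume "bounded_distortion (profile_map h)"
  moreover have "profile_map h ?p = ?p"
    using funpow_profile_map[OF h, of 1 0] profile_lift_0[OF h] by simp
  ultimately have "distortion (profile_map h) ?p < \<infinity>" by (simp add: bounded_distortion_def)
  then obtain B where B: "distortion (profile_map h) ?p \<le> ereal B"
    by (cases "distortion (profile_map h) ?p") auto
  have bound: "(\<Sum>k<n. h ((2/5) ^ Suc k / 2)) \<le> 2 * exp B" for n
  proof (cases "n = 0")
    case False
    obtain b where b: "0 < b" "(profile_lift h ^^ n) b = 1"
      by (rule funpow_profile_lift_hits[OF h, of 1 n]) auto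
    obtain x where x: "0 < x" "(profile_lift h ^^ n) x = 1/2"
      by (rule funpow_profile_lift_hits[OF h, of "1/2" n]) auto
    have "x < b"
      using funpow_profile_lift_strict_mono[OF h, of b x n] b x by (cases "x = b") force+
    have D: "0 < orbit_deriv h n y" for y by (rule orbit_deriv_pos[OF h])
    have "orbit_deriv h n x \<le> exp B * orbit_deriv h n y" if "0 < y" "y < b" for y
    proof -
      have "ereal (ln (orbit_deriv h n x / orbit_deriv h n y)) \<le> ereal B"
        using order_trans[OF distortion_at_0_ge[OF h _ b(2) x(1) \<open>x < b\<close> that] B] False by simp
      then have "exp (ln (orbit_deriv h n x / orbit_deriv h n y)) \<le> exp B" by simp
      then have "orbit_deriv h n x / orbit_deriv h n y \<le> exp B" using D by (simp add: exp_ln)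
      then show ?thesis using D by (simp add: pos_divide_le_eq)
    qed
    then have "eventually (\<lambda>y. orbit_deriv h n x \<le> exp B * orbit_deriv h n y) (at_right 0)"
      using eventually_at_right_real[OF b(1)] by (auto elim: eventually_mono)
    moreover have "isCont (orbit_deriv h n) 0"
      using continuous_on_orbit_deriv[OF h, of n] by (simp add: continuous_on_eq_continuous_at)
    then have "(orbit_deriv h n \<longlongrightarrow> orbit_deriv h n 0) (at_right 0)"
      by (simp add: isCont_def filterlim_at_split)
    then have "((\<lambda>y. exp B * orbit_deriv h n y) \<longlongrightarrow> exp B * orbit_deriv h n 0) (at_right 0)"
      by (intro tendsto_mult_left)
    ultimately have "orbit_deriv h n x \<le> exp B * orbit_deriv h n 0"
      by (intro tendsto_lowerbound) auto
    then have "orbit_deriv h n x / orbit_deriv h n 0 \<le> exp B"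
      using D by (simp add: pos_divide_le_eq)
    then show ?thesis using orbit_deriv_ratio_ge[OF h x] by linarith
  qed simp
  have "summable (\<lambda>k. h ((2/5) ^ Suc k / 2))"
  proof (rule summableI_nonneg_bounded[OF _ bound])
    fix k
    have "(2/5) ^ Suc k \<le> (1::real)" by (rule power_le_one) auto
    then show "0 \<le> h ((2/5) ^ Suc k / 2)" by (intro profile_bounds(1)[OF h]) auto
  qed
  then have "summable (\<lambda>k. h ((2/5) ^ k / 2))" by (subst (asm) summable_Suc_iff)
  with assms(2) show False by contradiction
qed

section \<open>Equivalence of moduli\<close>

lemma equiv_moduli_sym:
  assumes "equiv_moduli \<omega> \<omega>'" shows "equiv_moduli \<omega>' \<omega>"
proof -
  obtain t0 a b where ab: "0 < t0" "0 < a" "0 < b"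
    and r: "\<And>t. t \<in> {0<..t0} \<Longrightarrow> a \<le> \<omega> t / \<omega>' t \<and> \<omega> t / \<omega>' t \<le> b"
    using assms unfolding equiv_moduli_def by blast
  have inv: "1 / b \<le> 1 / q \<and> 1 / q \<le> 1 / a" if "a \<le> q" "q \<le> b" for q
    using that ab by (intro conjI frac_le) linarith+
  have "1 / b \<le> \<omega>' t / \<omega> t \<and> \<omega>' t / \<omega> t \<le> 1 / a" if "t \<in> {0<..t0}" for t
  proof -
    have "\<omega>' t / \<omega> t = 1 / (\<omega> t / \<omega>' t)" by simp
    then show ?thesis using r[OF that] inv by (simp only:)
  qed
  then show ?thesis unfolding equiv_moduli_def
    using ab by (intro exI[of _ t0] exI[of _ "1 / b"] exI[of _ "1 / a"] conjI ballI) auto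
qed

lemma equiv_moduli_trans:
  assumes "equiv_moduli \<omega> \<omega>'" "equiv_moduli \<omega>' \<omega>''" shows "equiv_moduli \<omega> \<omega>''"
proof -
  obtain t0 a b where ab: "0 < t0" "0 < a" "0 < b"
    and r: "\<And>t. t \<in> {0<..t0} \<Longrightarrow> a \<le> \<omega> t / \<omega>' t \<and> \<omega> t / \<omega>' t \<le> b"
    using assms(1) unfolding equiv_moduli_def by blast
  obtain t1 c d where cd: "0 < t1" "0 < c" "0 < d"
    and q: "\<And>t. t \<in> {0<..t1} \<Longrightarrow> c \<le> \<omega>' t / \<omega>'' t \<and> \<omega>' t / \<omega>'' t \<le> d"
    using assms(2) unfolding equiv_moduli_def by blast
  have "a * c \<le> \<omega> t / \<omega>'' t \<and> \<omega> t / \<omega>'' t \<le> b * d" if t: "t \<in> {0<..min t0 t1}" for t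
  proof -
    have r': "a \<le> \<omega> t / \<omega>' t" "\<omega> t / \<omega>' t \<le> b" and q': "c \<le> \<omega>' t / \<omega>'' t" "\<omega>' t / \<omega>'' t \<le> d"
      using r[of t] q[of t] t by auto
    have "\<omega>' t \<noteq> 0" using r'(1) ab(2) by auto
    then have "\<omega> t / \<omega>'' t = (\<omega> t / \<omega>' t) * (\<omega>' t / \<omega>'' t)" by simp
    moreover have "a * c \<le> (\<omega> t / \<omega>' t) * (\<omega>' t / \<omega>'' t)"
      using r' q' ab cd by (intro mult_mono) linarith+
    moreover have "(\<omega> t / \<omega>' t) * (\<omega>' t / \<omega>'' t) \<le> b * d"
      using r' q' ab cd by (intro mult_mono) linarith+
    ultimately show ?thesis by (simp only:)
  qed
  moreover have "0 < min t0 t1" "0 < a * c" "0 < b * d" using ab cd by simp_all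
  ultimately show ?thesis unfolding equiv_moduli_def by blast
qed

lemma equiv_moduli_cong:
  assumes "equiv_moduli \<omega> \<omega>''" "0 < T" "\<And>t. 0 < t \<Longrightarrow> t \<le> T \<Longrightarrow> \<omega>' t = \<omega> t"
  shows "equiv_moduli \<omega>' \<omega>''"
proof -
  obtain t0 a b where ab: "0 < t0" "0 < a" "0 < b"
    and r: "\<And>t. t \<in> {0<..t0} \<Longrightarrow> a \<le> \<omega> t / \<omega>'' t \<and> \<omega> t / \<omega>'' t \<le> b"
    using assms(1) unfolding equiv_moduli_def by blast
  then show ?thesis unfolding equiv_moduli_def
    using assms(2,3) by (intro exI[of _ "min t0 T"] exI[of _ a] exI[of _ b] conjI ballI) auto
qed

lemma profile_map_in_E1_class:
  assumes "h \<in> profiles"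
  shows "profile_map h \<in> E1_class \<omega> \<longleftrightarrow> equiv_moduli h \<omega>"
proof -
  have "modulus (circle_deriv (profile_map h)) t = h t" if "0 < t" "t \<le> 1/2" for t
    using modulus_profile_map[OF assms that(1)] that by (simp add: min_def)
  then have "equiv_moduli (modulus (circle_deriv (profile_map h))) \<omega> \<longleftrightarrow> equiv_moduli h \<omega>"
    using equiv_moduli_cong[of _ \<omega> "1/2"] by (metis half_gt_zero zero_less_one)
  then show ?thesis by (simp add: E1_class_def profile_map_in_E1[OF assms])
qed

text \<open>The ratio is \<open>(2 - ln t) powr (s - s')\<close>, which tends to 0 at 0 if \<open>s < s'\<close>.\<close>

lemma log_modulus_inequivalent:
  assumes "s < s'" shows "\<not> equiv_moduli (log_modulus s') (log_modulus s)"
proof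
  assume "equiv_moduli (log_modulus s') (log_modulus s)"
  then obtain t0 a where a: "0 < t0" "0 < a"
    and r: "\<And>t. t \<in> {0<..t0} \<Longrightarrow> a \<le> log_modulus s' t / log_modulus s t"
    unfolding equiv_moduli_def by blast
  have "((\<lambda>t. (2 - ln t) powr (- (s' - s))) \<longlongrightarrow> 0) (at_right (0::real))"
    using assms by (intro log_power_tendsto_0) simp
  moreover have "eventually (\<lambda>t. a \<le> (2 - ln t) powr (- (s' - s))) (at_right 0)"
  proof -
    have "eventually (\<lambda>t. t \<in> {0<..<min t0 1}) (at_right 0)"
      using a by (intro eventually_at_right_real) simp
    then show ?thesis
    proof eventually_elim
      case (elim t)
      have "a \<le> (2 - ln t) powr (- s') / (2 - ln t) powr (- s)"
        using r[of t] elim by (simp add: log_modulus_def)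
      also have "\<dots> = (2 - ln t) powr (- s' - - s)" by (rule powr_diff[symmetric])
      also have "- s' - - s = - (s' - s)" by simp
      finally show ?case .
    qed
  qed
  ultimately have "a \<le> 0" by (intro tendsto_lowerbound) auto
  with a show False by simp
qed

section \<open>Normalised moduli\<close>

text \<open>The normalisation separates: the value at \<open>1/2\<close> depends continuously on the map, so no map with
  a smaller value there is a limit of maps with normalised profiles.\<close>

definition normalized_moduli :: "(real \<Rightarrow> real) set" where
  "normalized_moduli = {h \<in> concave_moduli. h (1/2) = 1/2}"

lemma concave_modulus_pos:
  assumes "\<omega> \<in> concave_moduli" "0 < t" shows "0 < \<omega> t"
proof -
  have \<omega>: "mono_on {0..} \<omega>" "concave_on {0..} \<omega>" "\<omega> 0 = 0"
    using assms by (auto simp: concave_moduli_def)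
  obtain T where T: "0 \<le> T" "\<omega> T \<noteq> 0" "0 \<le> \<omega> T"
    using assms(1) by (auto simp: concave_moduli_def)
  then have T': "0 < T" "0 < \<omega> T" using \<omega>(3) by (auto simp: less_le)
  show ?thesis
  proof (cases "T \<le> t")
    case True
    then have "\<omega> T \<le> \<omega> t" using T by (intro mono_onD[OF \<omega>(1)]) auto
    then show ?thesis using T' by simp
  next
    case False
    have "t / T * \<omega> T \<le> \<omega> (t / T * T)"
      using False T' assms(2) by (intro concave_scale_le[OF \<omega>(2,3)]) auto
    moreover have "0 < t / T * \<omega> T" using T' assms(2) by simp
    ultimately show ?thesis using T' by simp
  qed
qed

lemma concave_modulus_small:
  assumes "\<omega> \<in> concave_moduli" "0 < e"
  obtains d where "0 < d" "\<And>t. 0 \<le> t \<Longrightarrow> t < d \<Longrightarrow> \<omega> t \<le> e"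
proof -
  have "continuous_on {0..} \<omega>" "\<omega> 0 = 0" using assms(1) by (auto simp: concave_moduli_def)
  then obtain d where d: "0 < d" "\<And>t. t \<in> {0..} \<Longrightarrow> dist t 0 < d \<Longrightarrow> dist (\<omega> t) 0 < e"
    unfolding continuous_on_iff using assms(2) by (metis atLeast_iff order_refl)
  then have "\<omega> t \<le> e" if "0 \<le> t" "t < d" for t
  proof -
    have "dist (\<omega> t) 0 < e" using d(2)[of t] that by (simp add: dist_real_def)
    then show ?thesis by (simp add: dist_real_def)
  qed
  with d(1) show ?thesis by (rule that)
qed

lemma normalized_moduli_subset_profiles: "normalized_moduli \<subseteq> profiles"
proof
  fix h assume "h \<in> normalized_moduli"
  then have h: "continuous_on {0..} h" "mono_on {0..} h" "concave_on {0..} h" "h 0 = 0" "h (1/2) = 1/2"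
    by (auto simp: normalized_moduli_def concave_moduli_def)
  have sub: "{0..1/2} \<subseteq> {0::real..}" by auto
  have "concave_on {0..1/2} h"
    using h(3) convex_on_subset[OF _ sub] by (simp add: concave_on_def)
  then show "h \<in> profiles"
    using h continuous_on_subset[OF h(1) sub] mono_on_subset[OF h(2) sub] by (simp add: profiles_def)
qed

lemma ex_normalized_modulus:
  assumes "\<omega> \<in> concave_moduli" obtains h where "h \<in> normalized_moduli" "equiv_moduli h \<omega>"
proof -
  define c where "c = 1 / (2 * \<omega> (1/2))"
  have pos: "0 < \<omega> t" if "0 < t" for t by (rule concave_modulus_pos[OF assms that])
  then have c: "0 < c" by (simp add: c_def)
  have \<omega>: "continuous_on {0..} \<omega>" "mono_on {0..} \<omega>" "concave_on {0..} \<omega>" "\<And>t. t \<ge> 0 \<Longrightarrow> 0 \<le> \<omega> t" "\<omega> 0 = 0"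
    using assms by (auto simp: concave_moduli_def)
  have "(\<lambda>t. c * \<omega> t) \<in> concave_moduli"
    unfolding concave_moduli_def mem_Collect_eq
  proof (intro conjI)
    show "continuous_on {0..} (\<lambda>t. c * \<omega> t)" by (intro continuous_intros \<omega>)
    show "mono_on {0..} (\<lambda>t. c * \<omega> t)"
      using \<omega>(2) c by (auto simp: mono_on_def)
    show "concave_on {0..} (\<lambda>t. c * \<omega> t)" using c \<omega>(3) by (intro concave_on_cmul) auto
    show "\<exists>t\<ge>0. c * \<omega> t \<noteq> 0" using pos[of 1] c by (intro exI[of _ 1]) auto
  qed (use c \<omega> in auto)
  moreover have "c * \<omega> (1/2) = 1/2" using pos[of "1/2"] by (simp add: c_def)
  moreover have "equiv_moduli (\<lambda>t. c * \<omega> t) \<omega>"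
  proof -
    have "c * \<omega> t / \<omega> t = c" if "0 < t" for t using pos[OF that] by simp
    then show ?thesis unfolding equiv_moduli_def
      using c by (intro exI[of _ 1] exI[of _ c] conjI ballI) auto
  qed
  ultimately show ?thesis using that[of "\<lambda>t. c * \<omega> t"] by (simp add: normalized_moduli_def)
qed

text \<open>The values on a grid of mesh \<open>1 / N\<close>, rounded to multiples of \<open>1 / m\<close>, distribute the
  normalised moduli into countably many cells, which is what makes them separable. By
  subadditivity \<open>h\<close> varies by at most \<open>h (1 / N)\<close> between neighbouring grid points; the bound on
  this quantity makes the uniform diameter of a cell on \<open>{0..1/2}\<close> at most \<open>2 / m\<close>. For each \<open>m\<close>
  every modulus lies in some cell, since \<open>N\<close> can be adapted to it.\<close>

definition modulus_cell :: "nat \<times> nat \<times> int list \<Rightarrow> (real \<Rightarrow> real) set" where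
  "modulus_cell = (\<lambda>(m, N, l). {h \<in> normalized_moduli. h (1 / real N) \<le> 1 / real m \<and>
     l = map (\<lambda>k. \<lfloor>real m * h (real k / real N)\<rfloor>) [0..<Suc N]})"

lemma modulus_cell_diameter_aux:
  assumes "0 < m" "0 < N" and h: "h \<in> modulus_cell (m, N, l)" and h': "h' \<in> modulus_cell (m, N, l)"
    and t: "0 \<le> t" "t \<le> 1/2"
  shows "h t \<le> h' t + 2 / real m"
proof -
  define k where "k = nat \<lfloor>t * real N\<rfloor>"
  have "real k = of_int \<lfloor>t * real N\<rfloor>" using t by (simp add: k_def)
  then have "real k \<le> t * real N" "t * real N < real k + 1" by linarith+
  then have kt': "real k / real N \<le> t" "t \<le> (real k + 1) / real N"
    using \<open>0 < N\<close> by (simp_all add: pos_divide_le_eq pos_le_divide_eq)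
  then have kt: "real k / real N \<le> t" "t - real k / real N \<le> 1 / real N"
    by (simp_all add: add_divide_distrib)
  have "t * real N \<le> 1 * real N" using t by (intro mult_right_mono) auto
  then have "k < Suc N" using \<open>real k \<le> t * real N\<close> by linarith
  have *: "mono_on {0..} g" "concave_on {0..} g" "g 0 = 0" "g (1 / real N) \<le> 1 / real m"
    "l ! k = \<lfloor>real m * g (real k / real N)\<rfloor>" if "g \<in> modulus_cell (m, N, l)" for g
    using that \<open>k < Suc N\<close>
    by (auto simp: modulus_cell_def normalized_moduli_def concave_moduli_def simp del: upt_Suc)
  have "\<lfloor>real m * h (real k / real N)\<rfloor> = \<lfloor>real m * h' (real k / real N)\<rfloor>"
    using *(5)[OF h] *(5)[OF h'] by simp
  then have "real m * h (real k / real N) \<le> real m * h' (real k / real N) + 1" by linarith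
  then have "h (real k / real N) \<le> h' (real k / real N) + 1 / real m"
    using \<open>0 < m\<close> by (simp add: field_simps)
  moreover have "h t \<le> h (real k / real N) + h (t - real k / real N)"
    using concave_subadditive[OF *(2,3)[OF h], of "real k / real N" "t - real k / real N"] kt t by simp
  moreover have "h (t - real k / real N) \<le> h (1 / real N)"
    using kt by (intro mono_onD[OF *(1)[OF h]]) auto
  moreover have "h' (real k / real N) \<le> h' t"
    using kt t by (intro mono_onD[OF *(1)[OF h']]) auto
  ultimately show ?thesis using *(4)[OF h] by linarith
qed

lemma normalized_moduli_separable:
  "\<exists>r :: nat \<Rightarrow> real \<Rightarrow> real. (\<forall>n. r n \<in> normalized_moduli) \<and>
    (\<forall>h\<in>normalized_moduli. \<forall>e>0. \<exists>n. \<forall>t\<in>{0..1/2}. \<bar>h t - r n t\<bar> \<le> e)"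
proof -
  have "(\<lambda>t. t) \<in> normalized_moduli"
    by (auto simp: normalized_moduli_def concave_moduli_def concave_on_ident mono_on_def intro: exI[of _ 1])
  then have "\<exists>h. h \<in> normalized_moduli \<and> (modulus_cell (from_nat n) \<noteq> {} \<longrightarrow> h \<in> modulus_cell (from_nat n))" for n
    by (cases "modulus_cell (from_nat n) = {}") (auto simp: modulus_cell_def split: prod.splits)
  then obtain r where r: "\<And>n. r n \<in> normalized_moduli"
      "\<And>n. modulus_cell (from_nat n) \<noteq> {} \<Longrightarrow> r n \<in> modulus_cell (from_nat n)"
    by metis
  show ?thesis
  proof (intro exI[of _ r] conjI allI ballI impI r(1))
    fix h and e :: real assume h: "h \<in> normalized_moduli" and e: "0 < e"
    obtain m :: nat where m: "2 / e < real m" using reals_Archimedean2 by blast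
    have "0 < 2 / e" using e by simp
    then have "0 < m" using m by linarith
    then have "2 / real m \<le> e" using m e by (simp add: field_simps)
    obtain d where d: "0 < d" "\<And>t. 0 \<le> t \<Longrightarrow> t < d \<Longrightarrow> h t \<le> 1 / real m"
      using concave_modulus_small[of h "1 / real m"] h \<open>0 < m\<close> by (auto simp: normalized_moduli_def)
    obtain N where "inverse (real (Suc N)) < d" using reals_Archimedean[OF d(1)] by blast
    then have N: "h (1 / real (Suc N)) \<le> 1 / real m"
      by (intro d(2)) (auto simp: inverse_eq_divide)
    define c where "c = (m, Suc N, map (\<lambda>k. \<lfloor>real m * h (real k / real (Suc N))\<rfloor>) [0..<Suc (Suc N)])"
    have hc: "h \<in> modulus_cell c"
      using h N by (simp add: modulus_cell_def c_def del: upt_Suc)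
    then have rc: "r (to_nat c) \<in> modulus_cell c" using r(2)[of "to_nat c"] by auto
    have "\<bar>h t - r (to_nat c) t\<bar> \<le> e" if "0 \<le> t" "t \<le> 1/2" for t
      using modulus_cell_diameter_aux[OF \<open>0 < m\<close> _ hc[unfolded c_def] rc[unfolded c_def] that]
        modulus_cell_diameter_aux[OF \<open>0 < m\<close> _ rc[unfolded c_def] hc[unfolded c_def] that]
        \<open>2 / real m \<le> e\<close> by (simp add: c_def abs_le_iff)
    then show "\<exists>n. \<forall>t\<in>{0..1/2}. \<bar>h t - r n t\<bar> \<le> e" by (intro exI[of _ "to_nat c"]) simp
  qed
qed

text \<open>Along a geometric sequence the logarithm grows linearly, so the logarithmic moduli dominate a
  multiple of the harmonic series.\<close>

lemma log_modulus_geometric_ge: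
  assumes "0 < s" "s \<le> 1" shows "1 / (3 * real (Suc k)) \<le> log_modulus s ((2/5) ^ k / 2)"
proof -
  let ?t = "(2/5) ^ k / 2 :: real"
  have t: "0 < ?t" "?t \<le> 1" using power_le_one[of "2/5::real" k] by auto
  have "ln ?t = - (real k * ln (5/2) + ln 2)"
    by (simp add: ln_div ln_realpow algebra_simps)
  moreover have "real k * ln (5/2) \<le> real k * (3/2)"
    using ln_le_minus_one[of "5/2"] by (intro mult_left_mono) auto
  moreover have "ln 2 \<le> (1::real)" using ln_le_minus_one[of 2] by simp
  moreover have "real k * (3/2) \<le> 3 * real k" by simp
  ultimately have L: "2 - ln ?t \<le> 3 * real (Suc k)" by simp
  have "1 / (3 * real (Suc k)) \<le> 1 / (2 - ln ?t)"
    using L two_minus_ln_ge[OF t] by (intro frac_le) linarith+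
  also have "\<dots> = (2 - ln ?t) powr (- 1)"
  proof -
    have "0 \<le> 2 - ln ?t" using two_minus_ln_ge[OF t] by linarith
    then show ?thesis by (simp only: powr_minus_divide powr_one)
  qed
  also have "\<dots> \<le> (2 - ln ?t) powr (- s)"
    using two_minus_ln_ge[OF t] assms by (intro powr_mono) linarith+
  also have "\<dots> = log_modulus s ?t"
  proof -
    have "\<not> ?t \<le> 0" using t(1) by linarith
    then show ?thesis by (simp only: log_modulus_def if_False)
  qed
  finally show ?thesis .
qed

text \<open>A small shift makes the modulus Lipschitz, after which a small multiple of \<open>log_modulus s\<close>,
  being concave, dominates it up to a constant and alone determines the class.\<close>

lemma normalized_modulus_perturbation:
  assumes h: "h \<in> normalized_moduli" and s: "0 < s" "s \<le> 1" and e: "0 < e"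
  obtains u where "u \<in> profiles" "u (1/2) < 1/2" "equiv_moduli u (log_modulus s)"
    "\<not> summable (\<lambda>k. u ((2/5) ^ k / 2))"
    "\<And>t. 0 \<le> t \<Longrightarrow> t \<le> 1/2 \<Longrightarrow> \<bar>h t - u t\<bar> \<le> e"
proof -
  have hK: "h \<in> concave_moduli" and half: "h (1/2) = 1/2" using h by (auto simp: normalized_moduli_def)
  then have cont: "continuous_on {0..} h" and mono: "mono_on {0..} h" and conc: "concave_on {0..} h"
    and h0: "h 0 = 0" by (auto simp: concave_moduli_def)
  obtain d where d: "0 < d" "\<And>t. 0 \<le> t \<Longrightarrow> t < d \<Longrightarrow> h t \<le> e / 2"
    using concave_modulus_small[OF hK, of "e / 2"] e by auto
  define \<delta> where "\<delta> = d / 2"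
  have \<delta>: "0 < \<delta>" "h \<delta> \<le> e / 2" using d by (auto simp: \<delta>_def)
  define \<eta> where "\<eta> = min (1/2) (e / 2)"
  have \<eta>: "0 < \<eta>" "\<eta> \<le> 1/2" "\<eta> \<le> e / 2" using e by (auto simp: \<eta>_def)
  define k where "k t = h (t + \<delta>) - h \<delta>" for t
  define u where "u t = (1 - \<eta>) * k t + \<eta> / 2 * log_modulus s t" for t
  have k: "h t - h \<delta> \<le> k t" "k t \<le> h t" "0 \<le> k t" if "0 \<le> t" for t
    using concave_subadditive[OF conc h0, of t \<delta>] mono_onD[OF mono, of t "t + \<delta>"]
      mono_onD[OF mono, of \<delta> "t + \<delta>"] that \<delta> by (auto simp: k_def)
  have log0: "0 \<le> log_modulus s t" for t by (simp add: log_modulus_def)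
  have sub: "{0..1/2} \<subseteq> {0::real..}" "{0..1/2} \<subseteq> {0..1::real}" by auto
  have "u \<in> profiles" unfolding profiles_def mem_Collect_eq
  proof (intro conjI)
    have "continuous_on {0..1/2} (\<lambda>t. h (t + \<delta>))"
      by (rule continuous_on_compose2[OF cont]) (use \<delta> in \<open>auto intro!: continuous_intros\<close>)
    then show "continuous_on {0..1/2} u" unfolding u_def k_def
      by (intro continuous_intros continuous_on_subset[OF log_modulus_continuous[OF s(1)] sub(2)])
    show "mono_on {0..1/2} u"
    proof (rule mono_onI)
      fix a b :: real assume ab: "a \<in> {0..1/2}" "b \<in> {0..1/2}" "a \<le> b"
      have "k a \<le> k b" using mono_onD[OF mono, of "a + \<delta>" "b + \<delta>"] ab \<delta> by (simp add: k_def)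
      moreover have "log_modulus s a \<le> log_modulus s b" using ab s by (intro log_modulus_mono) auto
      ultimately show "u a \<le> u b" unfolding u_def
        using \<eta> by (intro add_mono mult_left_mono) auto
    qed
    have "concave_on {0..1/2} k"
      using concave_shift[OF conc, of \<delta>] \<delta> convex_on_subset[OF _ sub(1)]
      by (simp add: concave_on_def k_def[abs_def])
    moreover have "concave_on {0..1/2} (log_modulus s)"
      using log_modulus_concave[OF s] convex_on_subset[OF _ sub(2)] by (simp add: concave_on_def)
    ultimately show "concave_on {0..1/2} u" unfolding u_def[abs_def]
      using \<eta> by (intro concave_on_add concave_on_cmul) auto
  next
    show "u 0 = 0" by (simp add: u_def k_def)
  next
    show "u (1/2) \<le> 1/2"
    proof -
      have "(1 - \<eta>) * k (1/2) \<le> (1 - \<eta>) * (1/2)"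
        using k(2)[of "1/2"] half \<eta> by (intro mult_left_mono) auto
      moreover have "\<eta> / 2 * log_modulus s (1/2) \<le> \<eta> / 2 * 1"
        using log_modulus_less_1[OF s(1), of "1/2"] \<eta> by (intro mult_left_mono) auto
      ultimately show ?thesis unfolding u_def by (simp add: algebra_simps)
    qed
  qed
  moreover have "u (1/2) < 1/2"
  proof -
    have "(1 - \<eta>) * k (1/2) \<le> (1 - \<eta>) * (1/2)"
      using k(2)[of "1/2"] half \<eta> by (intro mult_left_mono) auto
    moreover have "\<eta> / 2 * log_modulus s (1/2) < \<eta> / 2 * 1"
      using log_modulus_less_1[OF s(1), of "1/2"] \<eta> by (intro mult_strict_left_mono) auto
    ultimately show ?thesis unfolding u_def by (simp add: algebra_simps)
  qed
  moreover have lower: "\<eta> / 2 * log_modulus s t \<le> u t" if "0 \<le> t" for t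
    using k(3)[OF that] \<eta> by (simp add: u_def)
  have "equiv_moduli u (log_modulus s)"
  proof -
    define C where "C = h \<delta> / \<delta> / log_modulus s 1"
    have log1: "0 < log_modulus s 1" by (rule log_modulus_pos) auto
    have "0 < h \<delta>" by (rule concave_modulus_pos[OF hK \<delta>(1)])
    then have C: "0 < C" using \<delta> log1 by (simp add: C_def)
    have "\<eta> / 2 \<le> u t / log_modulus s t \<and> u t / log_modulus s t \<le> C + 1" if t: "t \<in> {0<..1/2}" for t
    proof
      have pos: "0 < log_modulus s t" using t by (intro log_modulus_pos) auto
      then show "\<eta> / 2 \<le> u t / log_modulus s t" using lower[of t] t by (simp add: pos_le_divide_eq)
      have "t * log_modulus s 1 \<le> log_modulus s (t * 1)"
        using t by (intro concave_scale_le[OF log_modulus_concave[OF s]]) auto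
      then have "t \<le> log_modulus s t / log_modulus s 1" using log1 by (simp add: pos_le_divide_eq)
      then have "h \<delta> / \<delta> * t \<le> h \<delta> / \<delta> * (log_modulus s t / log_modulus s 1)"
        using \<open>0 < h \<delta>\<close> \<delta> by (intro mult_left_mono) auto
      moreover have "k t \<le> h \<delta> / \<delta> * t"
        using concave_shift_Lipschitz[OF conc h0 \<delta>(1), of t] t by (simp add: k_def)
      ultimately have "k t \<le> C * log_modulus s t" by (simp add: C_def)
      moreover have "(1 - \<eta>) * k t \<le> 1 * k t" using k(3)[of t] \<eta> t by (intro mult_right_mono) auto
      moreover have "\<eta> / 2 * log_modulus s t \<le> 1 * log_modulus s t" using \<eta> log0 by (intro mult_right_mono) auto
      ultimately have "u t \<le> (C + 1) * log_modulus s t" by (simp add: u_def algebra_simps)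
      then show "u t / log_modulus s t \<le> C + 1" using pos by (simp add: pos_divide_le_eq)
    qed
    then show ?thesis unfolding equiv_moduli_def
      using C \<eta> by (intro exI[of _ "1/2"] exI[of _ "\<eta> / 2"] exI[of _ "C + 1"] conjI) auto
  qed
  moreover have "\<not> summable (\<lambda>k. u ((2/5) ^ k / 2))"
  proof
    assume sum: "summable (\<lambda>k. u ((2/5) ^ k / 2))"
    have "summable (\<lambda>k. \<eta> / 6 * inverse (real (Suc k)))"
    proof (rule summable_comparison_test'[OF sum, of 0])
      fix j :: nat
      have "\<eta> / 6 * inverse (real (Suc j)) = \<eta> / 2 * (1 / (3 * real (Suc j)))"
        by (simp add: field_simps)
      also have "\<dots> \<le> \<eta> / 2 * log_modulus s ((2/5) ^ j / 2)"
        using \<eta> log_modulus_geometric_ge[OF s] by (intro mult_left_mono) auto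
      also have "\<dots> \<le> u ((2/5) ^ j / 2)" by (intro lower) simp
      finally show "norm (\<eta> / 6 * inverse (real (Suc j))) \<le> u ((2/5) ^ j / 2)" using \<eta> by simp
    qed
    then have "summable (\<lambda>k. inverse (real (Suc k)))" using \<eta> by (simp add: summable_cmult_iff)
    then show False using not_summable_harmonic[where 'a = real] by (subst (asm) summable_Suc_iff) simp
  qed
  moreover have "\<bar>h t - u t\<bar> \<le> e" if t: "0 \<le> t" "t \<le> 1/2" for t
  proof -
    have "h t \<le> 1/2" using mono_onD[OF mono, of t "1/2"] t half by simp
    then have "\<eta> * k t \<le> \<eta> * 1" using k(2)[OF t(1)] \<eta> by (intro mult_left_mono) auto
    moreover have "0 \<le> \<eta> * k t" using k(3)[OF t(1)] \<eta> by simp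
    moreover have "\<eta> * log_modulus s t \<le> \<eta> * 1"
      using log_modulus_less_1[OF s(1), of t] \<eta> t by (intro mult_left_mono) auto
    moreover have "0 \<le> \<eta> * log_modulus s t" using log0 \<eta> by simp
    moreover have "h t - u t = (h t - k t) + \<eta> * k t - \<eta> * log_modulus s t / 2"
      by (simp add: u_def algebra_simps)
    ultimately show ?thesis using k[OF t(1)] \<delta>(2) \<eta> unfolding abs_le_iff by linarith
  qed
  ultimately show ?thesis by (rule that)
qed

section \<open>The transversal\<close>

lemma modulus_circle_deriv_diff_le:
  assumes "0 \<le> t"
  shows "\<bar>modulus (circle_deriv f) t - modulus (circle_deriv g) t\<bar> \<le> dist_C1mod f g"
proof -
  obtain B C where B: "\<And>\<theta>. \<bar>circle_deriv f \<theta>\<bar> \<le> B" and C: "\<And>\<theta>. \<bar>circle_deriv g \<theta>\<bar> \<le> C"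
    by (meson circle_deriv_bounded)
  have "dist (circle_deriv f \<theta>) (circle_deriv g \<theta>) \<le> B + C" for \<theta>
    using B[of \<theta>] C[of \<theta>] by (simp add: dist_real_def)
  then have "0 \<le> sup_dist UNIV (circle_deriv f) (circle_deriv g)" by (intro sup_dist_nonneg) auto
  moreover have "0 \<le> sup_dist UNIV f g" by (rule sup_dist_nonneg[of _ _ _ 1]) (auto intro: circle_dist_le_1)
  moreover have "dist (modulus (circle_deriv f) t) (modulus (circle_deriv g) t)
      \<le> sup_dist {0..} (modulus (circle_deriv f)) (modulus (circle_deriv g))"
  proof (rule sup_dist_upper)
    fix s
    show "dist (modulus (circle_deriv f) s) (modulus (circle_deriv g) s) \<le> 2 * B + 2 * C"
      using modulus_bounded[of "circle_deriv f" B s] modulus_bounded[of "circle_deriv g" C s] B C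
      by (simp add: dist_real_def)
  qed (use assms in simp)
  ultimately show ?thesis by (simp add: dist_C1mod_def dist_C1_def dist_real_def)
qed

lemma openin_modulus_neq:
  assumes "0 \<le> t"
  shows "openin C1mod_topology {f \<in> E1. modulus (circle_deriv f) t \<noteq> v}"
proof -
  interpret Metric_space E1 dist_C1mod by (rule Metric_space_E1)
  have "mball f \<bar>modulus (circle_deriv f) t - v\<bar> \<subseteq> {f \<in> E1. modulus (circle_deriv f) t \<noteq> v}" for f
  proof
    fix g assume "g \<in> mball f \<bar>modulus (circle_deriv f) t - v\<bar>"
    then have "g \<in> E1" "dist_C1mod f g < \<bar>modulus (circle_deriv f) t - v\<bar>" by (auto simp: in_mball)
    then show "g \<in> {f \<in> E1. modulus (circle_deriv f) t \<noteq> v}"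
      using modulus_circle_deriv_diff_le[OF assms, of f g] by auto
  qed
  then show ?thesis
    unfolding C1mod_topology_def openin_mtopology
    by (auto intro!: exI[of _ "\<bar>modulus (circle_deriv _) t - v\<bar>"])
qed

lemma residual_in_open_dense:
  assumes "openin X U" "X closure_of U = topspace X" "U \<subseteq> A"
  shows "residual_in X A"
  using assms unfolding residual_in_def by (intro exI[of _ "\<lambda>_. U"]) auto

theorem theorem4:
  shows "\<exists>\<Gamma>. \<Gamma> \<subseteq> E1 \<and>
    (\<forall>\<omega>\<in>concave_moduli. \<exists>!f. f \<in> \<Gamma> \<inter> E1_class \<omega>) \<and>
    residual_in (subtopology C1mod_topology \<Gamma>) {f \<in> \<Gamma>. unbounded_distortion f}"
proof -
  interpret Metric_space E1 dist_C1mod by (rule Metric_space_E1)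
  obtain r :: "nat \<Rightarrow> real \<Rightarrow> real" where "(\<forall>n. r n \<in> normalized_moduli) \<and>
      (\<forall>h\<in>normalized_moduli. \<forall>e>0. \<exists>n. \<forall>t\<in>{0..1/2}. \<bar>h t - r n t\<bar> \<le> e)"
    using normalized_moduli_separable by (rule exE)
  then have r: "\<And>n. r n \<in> normalized_moduli"
    and dense: "\<And>h e. h \<in> normalized_moduli \<Longrightarrow> 0 < e \<Longrightarrow>
      \<exists>n. \<forall>t\<in>{0..1/2}. \<bar>h t - r n t\<bar> \<le> e"
    by simp_all
  define s where "s i = 1 / real (Suc i)" for i
  have s: "0 < s i" "s i \<le> 1" for i by (auto simp: s_def)
  \<comment> \<open>Index \<open>i\<close> encodes a member \<open>r n\<close> of the dense sequence and an accuracy \<open>1 / (m + 1)\<close>; the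
    exponent \<open>s i\<close> puts the perturbed moduli into pairwise distinct classes.\<close>
  have "\<exists>u. u \<in> profiles \<and> u (1/2) < 1/2 \<and> equiv_moduli u (log_modulus (s i)) \<and>
      \<not> summable (\<lambda>k. u ((2/5) ^ k / 2)) \<and>
      (\<forall>t. 0 \<le> t \<longrightarrow> t \<le> 1/2 \<longrightarrow> \<bar>r (fst (prod_decode i)) t - u t\<bar> \<le> 1 / real (Suc (snd (prod_decode i))))" for i
  proof -
    have "0 < 1 / real (Suc (snd (prod_decode i)))" by simp
    from normalized_modulus_perturbation[OF r s this] show ?thesis by metis
  qed
  then obtain u where u: "\<And>i. u i \<in> profiles" "\<And>i. u i (1/2) < 1/2"
      "\<And>i. equiv_moduli (u i) (log_modulus (s i))" "\<And>i. \<not> summable (\<lambda>k. u i ((2/5) ^ k / 2))"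
    and approx: "\<And>i t. 0 \<le> t \<Longrightarrow> t \<le> 1/2 \<Longrightarrow>
      \<bar>r (fst (prod_decode i)) t - u i t\<bar> \<le> 1 / real (Suc (snd (prod_decode i)))"
    by metis
  have u_inj: "i = j" if "equiv_moduli (u i) (u j)" for i j
  proof -
    have ij: "equiv_moduli (log_modulus (s i)) (log_modulus (s j))"
      using that u(3) equiv_moduli_sym equiv_moduli_trans by blast
    then have "\<not> s j < s i" "\<not> s i < s j"
      using log_modulus_inequivalent equiv_moduli_sym by blast+
    then show ?thesis by (simp add: s_def field_simps)
  qed

  define rep where "rep \<omega> = (SOME h. h \<in> normalized_moduli \<and> equiv_moduli h \<omega>)" for \<omega>
  have rep: "rep \<omega> \<in> normalized_moduli \<and> equiv_moduli (rep \<omega>) \<omega>" if \<omega>: "\<omega> \<in> concave_moduli" for \<omega>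
  proof -
    obtain h where "h \<in> normalized_moduli" "equiv_moduli h \<omega>"
      by (rule ex_normalized_modulus[OF \<omega>])
    then show ?thesis
      unfolding rep_def by (intro someI[of "\<lambda>h. h \<in> normalized_moduli \<and> equiv_moduli h \<omega>"]) simp
  qed
  have rep_eq: "rep \<omega> = rep \<omega>'" if "equiv_moduli \<omega> \<omega>'" for \<omega> \<omega>'
  proof -
    have "equiv_moduli h \<omega> \<longleftrightarrow> equiv_moduli h \<omega>'" for h
      using that equiv_moduli_sym equiv_moduli_trans by blast
    then show ?thesis by (simp add: rep_def)
  qed

  \<comment> \<open>Classes met by some \<open>u i\<close> are represented by its map, the others by their chosen
    normalised modulus, which depends on the class only.\<close>
  define K' where "K' = {\<omega> \<in> concave_moduli. \<forall>i. \<not> equiv_moduli (u i) \<omega>}"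
  define U where "U = range (\<lambda>i. profile_map (u i))"
  define G where "G = (\<lambda>\<omega>. profile_map (rep \<omega>)) ` K'"
  have rep_profile: "rep \<omega> \<in> profiles" if "\<omega> \<in> K'" for \<omega>
    using rep[of \<omega>] that normalized_moduli_subset_profiles by (auto simp: K'_def)
  have \<Gamma>: "U \<union> G \<subseteq> E1"
    using u(1) rep_profile by (auto simp: U_def G_def intro: profile_map_in_E1)

  have unique: "\<exists>!f. f \<in> (U \<union> G) \<inter> E1_class \<omega>" if \<omega>: "\<omega> \<in> concave_moduli" for \<omega>
  proof -
    have U_iff: "profile_map (u i) \<in> E1_class \<omega> \<longleftrightarrow> equiv_moduli (u i) \<omega>" for i
      by (rule profile_map_in_E1_class[OF u(1)])
    have G_iff: "profile_map (rep \<omega>') \<in> E1_class \<omega> \<longleftrightarrow> equiv_moduli \<omega>' \<omega>" if "\<omega>' \<in> K'" for \<omega>'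
    proof -
      have "equiv_moduli (rep \<omega>') \<omega>'" using rep that by (auto simp: K'_def)
      then have "equiv_moduli (rep \<omega>') \<omega> \<longleftrightarrow> equiv_moduli \<omega>' \<omega>"
        using equiv_moduli_sym equiv_moduli_trans by blast
      then show ?thesis using profile_map_in_E1_class[OF rep_profile[OF that]] by simp
    qed
    show ?thesis
    proof (cases "\<exists>i. equiv_moduli (u i) \<omega>")
      case True
      then obtain i where i: "equiv_moduli (u i) \<omega>" by blast
      show ?thesis
      proof (rule ex1I[of _ "profile_map (u i)"])
        show "profile_map (u i) \<in> (U \<union> G) \<inter> E1_class \<omega>" using i U_iff by (auto simp: U_def)
      next
        fix f assume f: "f \<in> (U \<union> G) \<inter> E1_class \<omega>"
        have "f \<notin> G"
        proof
          assume "f \<in> G"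
          then obtain \<omega>' where "\<omega>' \<in> K'" "equiv_moduli \<omega>' \<omega>" using f G_iff by (auto simp: G_def)
          then show False
            using i equiv_moduli_sym equiv_moduli_trans unfolding K'_def by blast
        qed
        then obtain j where j: "f = profile_map (u j)" "equiv_moduli (u j) \<omega>"
          using f U_iff by (auto simp: U_def)
        then have "j = i" using i u_inj equiv_moduli_sym equiv_moduli_trans by blast
        then show "f = profile_map (u i)" using j by simp
      qed
    next
      case False
      then have "\<omega> \<in> K'" using \<omega> by (simp add: K'_def)
      show ?thesis
      proof (rule ex1I[of _ "profile_map (rep \<omega>)"])
        have "equiv_moduli \<omega> \<omega>"
          using rep[OF \<omega>] equiv_moduli_sym equiv_moduli_trans by blast
        then show "profile_map (rep \<omega>) \<in> (U \<union> G) \<inter> E1_class \<omega>"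
          using G_iff \<open>\<omega> \<in> K'\<close> by (auto simp: G_def)
      next
        fix f assume f: "f \<in> (U \<union> G) \<inter> E1_class \<omega>"
        then have "f \<notin> U" using False U_iff by (auto simp: U_def)
        then obtain \<omega>' where "\<omega>' \<in> K'" "f = profile_map (rep \<omega>')" "equiv_moduli \<omega>' \<omega>"
          using f G_iff by (auto simp: G_def)
        then show "f = profile_map (rep \<omega>)" using rep_eq by simp
      qed
    qed
  qed

  have half: "modulus (circle_deriv (profile_map h)) (1/2) = h (1/2)" if "h \<in> profiles" for h
    using modulus_profile_map[OF that, of "1/2"] by simp
  \<comment> \<open>The modulus at \<open>1/2\<close> distinguishes \<open>U\<close> from \<open>G\<close>.\<close>
  have "openin (subtopology C1mod_topology (U \<union> G)) U"
  proof -
    have "f \<in> E1 \<and> modulus (circle_deriv f) (1/2) \<noteq> 1/2" if U: "f \<in> U" for f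
    proof -
      obtain i where "f = profile_map (u i)" using U by (auto simp: U_def)
      then show ?thesis using half[OF u(1)] u(2)[of i] profile_map_in_E1[OF u(1)] by simp
    qed
    moreover have "modulus (circle_deriv f) (1/2) = 1/2" if "f \<in> G" for f
      using that half rep_profile rep by (auto simp: G_def K'_def normalized_moduli_def)
    ultimately have "U = {f \<in> E1. modulus (circle_deriv f) (1/2) \<noteq> 1/2} \<inter> (U \<union> G)" by blast
    then show ?thesis
      using openin_modulus_neq[of "1/2" "1/2"] unfolding openin_subtopology by auto
  qed
  moreover have "subtopology C1mod_topology (U \<union> G) closure_of U
      = topspace (subtopology C1mod_topology (U \<union> G))"
  proof -
    have "\<exists>g\<in>U. g \<in> mball f \<epsilon>" if f: "f \<in> G" and \<epsilon>: "0 < \<epsilon>" for f \<epsilon>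
    proof -
      obtain h where h: "h \<in> normalized_moduli" "h \<in> profiles" "f = profile_map h"
        using f rep rep_profile by (auto simp: G_def K'_def)
      obtain m where m: "inverse (real (Suc m)) < \<epsilon> / 20" using reals_Archimedean[of "\<epsilon> / 20"] \<epsilon> by auto
      have "0 < \<epsilon> / 20" using \<epsilon> by simp
      from dense[OF h(1) this] obtain n where n: "\<forall>t\<in>{0..1/2}. \<bar>h t - r n t\<bar> \<le> \<epsilon> / 20"
        by (rule exE)
      let ?i = "prod_encode (n, m)"
      have "\<bar>h t - u ?i t\<bar> \<le> \<epsilon> / 10" if "0 \<le> t" "t \<le> 1/2" for t
      proof -
        have "\<bar>h t - r n t\<bar> \<le> \<epsilon> / 20" using bspec[OF n, of t] that by simp
        moreover have "\<bar>r n t - u ?i t\<bar> \<le> inverse (real (Suc m))"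
          using approx[OF that, of ?i] by (simp add: inverse_eq_divide)
        ultimately show ?thesis using m by linarith
      qed
      from dist_C1mod_profile_map_le[OF h(2) u(1) this]
      have "dist_C1mod f (profile_map (u ?i)) < \<epsilon>" using \<epsilon> h(3) by simp
      then show ?thesis
        using f \<Gamma> profile_map_in_E1[OF u(1)] by (auto simp: U_def in_mball)
    qed
    then have "G \<subseteq> C1mod_topology closure_of U"
      using \<Gamma> unfolding C1mod_topology_def metric_closure_of by auto
    moreover have "U \<subseteq> C1mod_topology closure_of U"
      using \<Gamma> by (intro closure_of_subset) (auto simp: C1mod_topology_def)
    moreover have "(U \<union> G) \<inter> U = U" by blast
    ultimately show ?thesis
      using \<Gamma> by (auto simp: closure_of_subtopology C1mod_topology_def)
  qed
  moreover have "U \<subseteq> {f \<in> U \<union> G. unbounded_distortion f}"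
    using unbounded_distortion_profile_map[OF u(1,4)] by (auto simp: U_def)
  ultimately have "residual_in (subtopology C1mod_topology (U \<union> G)) {f \<in> U \<union> G. unbounded_distortion f}"
    by (rule residual_in_open_dense)
  then show ?thesis using \<Gamma> unique by (intro exI[of _ "U \<union> G"]) simp
qed

end
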